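(* Let $p,q,r\in(0,1)$ with $p+q+r=1$. Let $X_1,\eta_2,\eta_3,\ldots$ be independent random variables, each taking the values $1,-1,0$ with probabilities $p,q,r$ respectively, and let $K_3,K_4,\ldots$ be i.i.d. random variables, uniformly distributed on $\{1,2\}$ and independent of the previous ones. Set $X_2=\eta_2X_1$, $X_{n+1}=\eta_{n+1}X_{K_{n+1}}$ for $n\ge2$, and $S_n=\sum_{k=1}^nX_k$. For $x_1,x_2\in\{-1,0,1\}$ put $\mu(x_1,x_2)=(p-q)(x_1+x_2)/2$ and $\sigma^2(x_1,x_2)=(p+q)(x_1^2+x_2^2)/2-\mu^2(x_1,x_2)$, with $\sigma(x_1,x_2)\ge0$. Then: (a) as $n\to\infty$, $\dfrac{S_n-n(p-q)(X_1+X_2)/2}{\sqrt n}$ converges in distribution to the law with distribution function $F(x)=p(p+q)\Phi(x/\sigma_1)+r(p+q)\Phi(x/\sigma_2)+q(p+q)\Phi(x/\sigma_3)+r\,\mathbf 1\{x\ge0\}$, where $\Phi$ is the standard normal distribution function and $\sigma_1^2=p+q-(p-q)^2$, $\sigma_2^2=\frac{p+q}{2}-\big(\frac{p-q}{2}\big)^2$, $\sigma_3^2=p+q$; (b) $\dfrac{S_n-n(p-q)(X_1+X_2)/2}{n}\to0$ almost surely as $n\to\infty$; (c) for almost all $\omega\in\{X_1^2+X_2^2\neq0\}$, $\limsup_{n\to\infty}\dfrac{S_n-n(p-q)(X_1+X_2)/2}{\sqrt{2n\log\log n}}=\sigma(X_1,X_2)$ and $\liminf_{n\to\infty}\dfrac{S_n-n(p-q)(X_1+X_2)/2}{\sqrt{2n\log\log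 n}}=-\sigma(X_1,X_2)$.
   Context: This is the elephant random walk with delays in which the elephant remembers only the first two steps. The limit in (a) is the mixture $p(p+q)\mathcal N_{0,\sigma_1^2}+r(p+q)\mathcal N_{0,\sigma_2^2}+q(p+q)\mathcal N_{0,\sigma_3^2}+r\delta_0$. *)

theory Defs
  imports "HOL-Probability.Probability"
begin

datatype erw_idx = IX1 | IEta nat | IK nat

definition erw_family ::
  "('a \<Rightarrow> real) \<Rightarrow> (nat \<Rightarrow> 'a \<Rightarrow> real) \<Rightarrow> (nat \<Rightarrow> 'a \<Rightarrow> nat) \<Rightarrow> erw_idx \<Rightarrow> 'a \<Rightarrow> real" where
  "erw_family X1 eta K i \<omega> = (case i of IX1 \<Rightarrow> X1 \<omega> | IEta n \<Rightarrow> eta n \<omega> | IK n \<Rightarrow> real (K n \<omega>))"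

definition erw_index :: "erw_idx set" where
  "erw_index = {IX1} \<union> IEta ` {2..} \<union> IK ` {3..}"

text \<open>The steps X_n (1-indexed; X_0 = 0 is a dummy value):
  X_1, X_2 = eta_2 X_1, X_{n+1} = eta_{n+1} X_{K_{n+1}} for n \<ge> 2.\<close>
fun erw_X ::
  "('a \<Rightarrow> real) \<Rightarrow> (nat \<Rightarrow> 'a \<Rightarrow> real) \<Rightarrow> (nat \<Rightarrow> 'a \<Rightarrow> nat) \<Rightarrow> nat \<Rightarrow> 'a \<Rightarrow> real" where
  "erw_X X1 eta K 0 \<omega> = 0"
| "erw_X X1 eta K (Suc 0) \<omega> = X1 \<omega>"
| "erw_X X1 eta K (Suc (Suc 0)) \<omega> = eta 2 \<omega> * X1 \<omega>"
| "erw_X X1 eta K (Suc (Suc (Suc n))) \<omega> =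
     eta (n + 3) \<omega> * (if K (n + 3) \<omega> = 1 then X1 \<omega> else eta 2 \<omega> * X1 \<omega>)"

definition erw_S ::
  "('a \<Rightarrow> real) \<Rightarrow> (nat \<Rightarrow> 'a \<Rightarrow> real) \<Rightarrow> (nat \<Rightarrow> 'a \<Rightarrow> nat) \<Rightarrow> nat \<Rightarrow> 'a \<Rightarrow> real" where
  "erw_S X1 eta K n \<omega> = (\<Sum>k=1..n. erw_X X1 eta K k \<omega>)"

definition Phi :: "real \<Rightarrow> real" where
  "Phi x = measure (density lborel std_normal_density) {..x}"

definition erw_mu :: "real \<Rightarrow> real \<Rightarrow> real \<Rightarrow> real \<Rightarrow> real" where
  "erw_mu p q x1 x2 = (p - q) * (x1 + x2) / 2"

definition erw_sigma :: "real \<Rightarrow> real \<Rightarrow> real \<Rightarrow> real \<Rightarrow> real" where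
  "erw_sigma p q x1 x2 = sqrt ((p + q) * (x1\<^sup>2 + x2\<^sup>2) / 2 - (erw_mu p q x1 x2)\<^sup>2)"

definition erw_F :: "real \<Rightarrow> real \<Rightarrow> real \<Rightarrow> real \<Rightarrow> real" where
  "erw_F p q r x =
     (let s1 = sqrt (p + q - (p - q)\<^sup>2);
          s2 = sqrt ((p + q) / 2 - ((p - q) / 2)\<^sup>2);
          s3 = sqrt (p + q)
      in p * (p + q) * Phi (x / s1) + r * (p + q) * Phi (x / s2)
         + q * (p + q) * Phi (x / s3) + r * (if x \<ge> 0 then 1 else 0))"

end

theory Submission
  imports Defs "HOL-Real_Asymp.Real_Asymp"
begin

text \<open>
  Given the first two steps, the remaining ones are bounded i.i.d. variables with mean
  \<open>erw_mu\<close> and standard deviation \<open>erw_sigma\<close>, independent of the first two steps. As these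
  take finitely many values, (b) and (c) follow from the law of the iterated logarithm for each
  fixed pair of values, and (a) from the central limit theorem for each pair, averaged over the
  pairs by independence.

  The law of the iterated logarithm for bounded i.i.d. variables is proved in the classical way.
  The upper half combines an exponential maximal inequality with the first Borel--Cantelli lemma
  along a geometric sequence of times. For the lower half, the tail of a sum is bounded from below
  by requiring each of about \<open>u\<^sup>2 / t\<^sup>2\<close> blocks to exceed \<open>t\<close> of its own standard deviations,
  an event whose probability the central limit theorem controls; the second Borel--Cantelli lemma
  then applies to the increments between the times \<open>m ^ k\<close>.
\<close>

section \<open>Bounded i.i.d. sequences\<close>

text \<open>The sharp constant tolerates no fixed loss in the Gaussian exponent, so each estimate
  has a parameter that drives its loss to zero. In the upper bound the variance is inflated by
  \<open>exp (l * B)\<close>, and the chosen \<open>l\<close> tends to 0. In the lower bound the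
  obstacle is that the central limit theorem speaks about a fixed level, while the level needed
  here, of order \<open>sqrt (ln (ln n))\<close>, grows; splitting into blocks brings it back to a
  fixed \<open>t\<close>, and a large \<open>t\<close> makes the loss per block small relative to
  \<open>t\<^sup>2\<close>. Lower bounds for increments are not yet lower bounds for sums: the sum
  up to \<open>m ^ k\<close> may be very negative. The upper half applied to the negated sequence
  controls it, and a large ratio \<open>m\<close> makes it small against the scale at
  \<open>m ^ Suc k\<close>. For the walk, the pair of zero steps has standard deviation 0 and
  escapes both limit theorems; there the centred walk vanishes from time 2 on, which produces the
  atom at 0. Cases are indexed by the values of \<open>X1\<close> and \<open>eta 2\<close>, which
  are independent, rather than by the two steps. At time \<open>n + 2\<close> the centred walk is a
  constant plus \<open>n\<close> i.i.d. terms, and this shift must be removed from each limit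
  statement.\<close>

lemma exp_le_quadratic:
  fixes y :: real
  shows "exp y \<le> 1 + y + y\<^sup>2 / 2 * exp \<bar>y\<bar>"
proof -
  obtain t where t: "\<bar>t\<bar> \<le> \<bar>y\<bar>" "exp y = (\<Sum>m<2. y ^ m / fact m) + exp t / fact 2 * y\<^sup>2"
    using Maclaurin_exp_le[of y 2] by auto
  have "exp t * y\<^sup>2 \<le> exp \<bar>y\<bar> * y\<^sup>2"
    using t(1) by (intro mult_right_mono) auto
  then show ?thesis
    using t(2) by (simp add: numeral_2_eq_2 mult.commute)
qed

lemma (in prob_space) indep_vars_block_sums:
  fixes X :: "'i \<Rightarrow> 'a \<Rightarrow> real"
  assumes "indep_vars (\<lambda>_. borel) X I"
    and "\<And>j. j \<in> L \<Longrightarrow> J j \<subseteq> I" and "disjoint_family_on J L"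
  shows "indep_vars (\<lambda>_. borel) (\<lambda>j \<omega>. \<Sum>i\<in>J j. X i \<omega>) L"
proof -
  have "indep_vars (\<lambda>_. borel) (\<lambda>j \<omega>. (\<lambda>x. \<Sum>i\<in>J j. x i) (restrict (\<lambda>i. X i \<omega>) (J j))) L"
    by (rule indep_vars_compose2[OF indep_vars_restrict[OF assms]]) auto
  moreover have "(\<lambda>j \<omega>. (\<lambda>x. \<Sum>i\<in>J j. x i) (restrict (\<lambda>i. X i \<omega>) (J j))) =
      (\<lambda>j \<omega>. \<Sum>i\<in>J j. X i \<omega>)"
    by (intro ext sum.cong) auto
  ultimately show ?thesis by simp
qed

text \<open>By independence and \<open>1 - p \<le> exp (- p)\<close>, the probability that no event
  occurs from \<open>N\<close> on is at most the exponential of minus any partial sum. If it were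
  positive, its logarithm would bound all the partial sums.\<close>

lemma (in prob_space) borel_cantelli2_AE:
  fixes Z :: "nat \<Rightarrow> 'a \<Rightarrow> real" and y :: "nat \<Rightarrow> real"
  assumes indep: "indep_vars (\<lambda>_. borel) Z UNIV"
    and div: "\<not> summable (\<lambda>k. prob {x \<in> space M. y k \<le> Z k x})"
  shows "AE x in M. \<exists>\<^sub>F k in sequentially. y k \<le> Z k x"
proof -
  have [measurable]: "random_variable borel (Z k)" for k
    using indep unfolding indep_vars_def2 by simp
  let ?p = "\<lambda>k. prob {x \<in> space M. y k \<le> Z k x}"
  have null: "AE x in M. \<exists>k\<ge>N. y k \<le> Z k x" for N
  proof -
    let ?E = "{x \<in> space M. \<forall>k\<ge>N. Z k x < y k}"
    have [measurable]: "?E \<in> events" by measurable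
    have bound: "prob ?E \<le> exp (- (\<Sum>k\<in>{N..<N+n}. ?p k))" for n
    proof (cases "n = 0")
      case False
      have "prob ?E \<le> prob (\<Inter>k\<in>{N..<N+n}. Z k -` {..<y k} \<inter> space M)"
        using False by (intro finite_measure_mono sets.finite_INT) (auto intro!: measurable_sets)
      also have "\<dots> = (\<Prod>k\<in>{N..<N+n}. prob (Z k -` {..<y k} \<inter> space M))"
        using False by (intro indep_varsD[OF indep]) auto
      also have "\<dots> \<le> (\<Prod>k\<in>{N..<N+n}. exp (- ?p k))"
      proof (intro prod_mono conjI)
        fix k
        have "prob (Z k -` {..<y k} \<inter> space M) = 1 - ?p k"
          by (subst prob_compl[symmetric]) (auto intro!: arg_cong[where f=prob])
        also have "\<dots> \<le> exp (- ?p k)"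
          using exp_ge_add_one_self[of "- ?p k"] by simp
        finally show "prob (Z k -` {..<y k} \<inter> space M) \<le> exp (- ?p k)" .
      qed simp
      also have "\<dots> = exp (- (\<Sum>k\<in>{N..<N+n}. ?p k))"
        by (simp add: exp_sum sum_negf[symmetric])
      finally show ?thesis .
    qed simp
    have "prob ?E = 0"
    proof (rule ccontr)
      assume "prob ?E \<noteq> 0"
      then have pos: "prob ?E > 0" by (simp add: zero_less_measure_iff)
      have "(\<Sum>k\<in>{N..<N+n}. ?p k) \<le> - ln (prob ?E)" for n
        using ln_mono[OF bound[of n] pos] by simp
      then have "(\<Sum>k<n. ?p (k + N)) \<le> - ln (prob ?E)" for n
        unfolding sum.shift_bounds_nat_ivl[of ?p 0 N n, symmetric, unfolded atLeast0LessThan]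
        by (simp add: add.commute[of n])
      then have "summable (\<lambda>k. ?p (k + N))"
        by (intro summableI_nonneg_bounded) auto
      then show False using div summable_iff_shift[of ?p N] by simp
    qed
    then have "AE x in M. x \<notin> ?E"
      by (intro AE_not_in) (auto simp: null_sets_def emeasure_eq_measure)
    then show ?thesis
      using AE_space by eventually_elim (auto simp: not_le)
  qed
  have "AE x in M. \<forall>N. \<exists>k\<ge>N. y k \<le> Z k x"
    using null by (simp add: AE_all_countable)
  then show ?thesis
    by eventually_elim (simp add: frequently_sequentially)
qed

definition reaches :: "real \<Rightarrow> nat \<Rightarrow> (nat \<Rightarrow> real) \<Rightarrow> bool" where
  "reaches y n x \<longleftrightarrow> (\<exists>j\<le>n. y \<le> (\<Sum>i<j. x i))"

text \<open>Freezing the exponential process at the first passage over \<open>y\<close> reduces the maximal inequality to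
  Markov's inequality.\<close>

primrec stopped_exp :: "real \<Rightarrow> real \<Rightarrow> nat \<Rightarrow> (nat \<Rightarrow> real) \<Rightarrow> real" where
  "stopped_exp l y 0 x = 1"
| "stopped_exp l y (Suc n) x =
     (if reaches y n x then stopped_exp l y n x else stopped_exp l y n x * exp (l * x n))"

lemma reaches_Suc: "reaches y (Suc n) x \<longleftrightarrow> reaches y n x \<or> y \<le> (\<Sum>i<Suc n. x i)"
  unfolding reaches_def by (auto simp only: le_Suc_eq)

lemma stopped_exp_before:
  "\<not> reaches y n x \<Longrightarrow> stopped_exp l y n x = exp (l * (\<Sum>i<n. x i))"
  by (induction n) (auto simp: reaches_Suc exp_add distrib_left)

lemma stopped_exp_after:
  assumes "0 \<le> l"
  shows "reaches y n x \<Longrightarrow> exp (l * y) \<le> stopped_exp l y n x"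
proof (induction n)
  case 0
  then show ?case using assms by (simp add: reaches_def mult_nonneg_nonpos)
next
  case (Suc n)
  show ?case
  proof (cases "reaches y n x")
    case True
    then show ?thesis using Suc.IH by simp
  next
    case False
    then have "y \<le> (\<Sum>i<Suc n. x i)" using Suc.prems by (simp add: reaches_Suc)
    then have "l * y \<le> l * (\<Sum>i<Suc n. x i)"
      using assms by (rule mult_left_mono)
    then show ?thesis
      using False by (simp add: stopped_exp_before distrib_left flip: exp_add)
  qed
qed

lemma stopped_exp_nonneg: "0 \<le> stopped_exp l y n x"
  by (induction n) auto

text \<open>First half of adaptedness: \<open>reaches\<close> and \<open>stopped_exp\<close> at time
  \<open>n\<close> depend on the coordinates below \<open>n\<close> only. With measurability over
  any index set containing those coordinates, this makes the past a function of variables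
  independent of \<open>X n\<close>.\<close>

lemma reaches_cong:
  assumes "\<And>i. i < n \<Longrightarrow> x i = x' i"
  shows "reaches y n x = reaches y n x'"
proof -
  have "(\<Sum>i<j. x i) = (\<Sum>i<j. x' i)" if "j \<le> n" for j
    using assms that by (intro sum.cong) auto
  then show ?thesis unfolding reaches_def by (intro ex_cong1 conj_cong) auto
qed

lemma stopped_exp_cong:
  "(\<And>i. i < n \<Longrightarrow> x i = x' i) \<Longrightarrow> stopped_exp l y n x = stopped_exp l y n x'"
proof (induction n)
  case (Suc n)
  then have "reaches y n x = reaches y n x'" by (intro reaches_cong) simp
  with Suc show ?case by simp
qed simp

lemma measurable_reaches:
  assumes "{..<n} \<subseteq> A"
  shows "Measurable.pred (PiM A (\<lambda>_. borel)) (reaches y n)"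
proof -
  have "Measurable.pred (PiM A (\<lambda>_. borel)) (\<lambda>x. y \<le> (\<Sum>i<j. x i))" if "j \<in> {..n}" for j
  proof -
    have "{..<j} \<subseteq> A" using assms that by fastforce
    then have [measurable]: "(\<lambda>x. \<Sum>i<j. x i) \<in> borel_measurable (PiM A (\<lambda>_. borel :: real measure))"
      by (intro borel_measurable_sum measurable_component_singleton) auto
    show ?thesis by measurable
  qed
  then have "Measurable.pred (PiM A (\<lambda>_. borel)) (\<lambda>x. \<exists>j\<in>{..n}. y \<le> (\<Sum>i<j. x i))"
    by (intro pred_intros_finite) auto
  then show ?thesis unfolding reaches_def[abs_def] Bex_def atMost_iff .
qed

lemma measurable_stopped_exp:
  "{..<n} \<subseteq> A \<Longrightarrow> stopped_exp l y n \<in> borel_measurable (PiM A (\<lambda>_. borel))"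
proof (induction n)
  case (Suc n)
  then have sub: "{..<n} \<subseteq> A" "n \<in> A" by auto
  note [measurable] = Suc.IH[OF sub(1)] measurable_reaches[OF sub(1), of y]
    measurable_component_singleton[OF sub(2), of "\<lambda>_. borel :: real measure"]
  have "(\<lambda>x. if reaches y n x then stopped_exp l y n x else stopped_exp l y n x * exp (l * x n))
      \<in> borel_measurable (PiM A (\<lambda>_. borel))"
    by measurable
  then show ?case by (simp cong: measurable_cong_simp)
next
  case 0
  have "(\<lambda>x. 1) \<in> borel_measurable (PiM A (\<lambda>_. borel))" by simp
  then show ?case by (simp cong: measurable_cong_simp)
qed

text \<open>The bound is only almost sure because the walk's variables take their three values only
  almost surely. Positivity of \<open>\<sigma>\<close> excludes the constant sequence, which the
  walk treats separately.\<close>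

locale bounded_iid = prob_space +
  fixes X :: "nat \<Rightarrow> 'a \<Rightarrow> real" and B \<sigma> :: real
  assumes indep: "indep_vars (\<lambda>_. borel) X UNIV"
    and ident: "\<And>n. distr M borel (X n) = distr M borel (X 0)"
    and bounded: "\<And>n. AE x in M. \<bar>X n x\<bar> \<le> B"
    and mean_zero: "\<And>n. expectation (X n) = 0"
    and second_moment: "\<And>n. expectation (\<lambda>x. (X n x)\<^sup>2) = \<sigma>\<^sup>2"
    and sigma_pos: "\<sigma> > 0"
begin

abbreviation S :: "nat \<Rightarrow> 'a \<Rightarrow> real" where
  "S n x \<equiv> \<Sum>i<n. X i x"

lemma rv [measurable]: "random_variable borel (X n)"
  using indep unfolding indep_vars_def2 by simp

lemma integrable_bounded_comp:
  assumes [measurable]: "f \<in> borel_measurable borel"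
    and "\<And>x. \<bar>x\<bar> \<le> B \<Longrightarrow> \<bar>f x\<bar> \<le> C"
  shows "integrable M (\<lambda>x. f (X n x) :: real)"
  by (rule integrable_const_bound[where B=C]) (use bounded[of n] assms(2) in auto)

lemma B_nonneg: "0 \<le> B"
proof -
  have "AE x in M. 0 \<le> B" using bounded[of 0] by eventually_elim auto
  then show ?thesis by simp
qed

lemma integrable_X: "integrable M (X n)"
  using integrable_bounded_comp[of "\<lambda>x. x" B] by simp

lemma integrable_X_square: "integrable M (\<lambda>x. (X n x)\<^sup>2)"
  using integrable_bounded_comp[of "\<lambda>x. x\<^sup>2" "B\<^sup>2"] by (simp add: abs_le_square_iff[symmetric])

lemma integrable_exp_X:
  assumes "0 \<le> l"
  shows "integrable M (\<lambda>x. exp (l * X n x))"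
proof (rule integrable_bounded_comp[of "\<lambda>x. exp (l * x)" "exp (l * B)"])
  fix x :: real assume "\<bar>x\<bar> \<le> B"
  then have "l * x \<le> l * B" using assms by (intro mult_left_mono) auto
  then show "\<bar>exp (l * x)\<bar> \<le> exp (l * B)" by simp
qed simp

text \<open>Taylor expansion to second order: the linear term has mean zero, and the remainder keeps
  the exact variance times \<open>exp (l * B)\<close>. That factor tends to 1 as \<open>l\<close>
  tends to 0, which preserves the sharp constant.\<close>

lemma mgf_le:
  assumes "0 \<le> l"
  shows "expectation (\<lambda>x. exp (l * X n x)) \<le> exp (l\<^sup>2 * \<sigma>\<^sup>2 * exp (l * B) / 2)"
proof -
  have "expectation (\<lambda>x. exp (l * X n x))
      \<le> expectation (\<lambda>x. 1 + l * X n x + l\<^sup>2 * exp (l * B) / 2 * (X n x)\<^sup>2)"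
  proof (rule integral_mono_AE)
    show "AE x in M. exp (l * X n x) \<le> 1 + l * X n x + l\<^sup>2 * exp (l * B) / 2 * (X n x)\<^sup>2"
      using bounded[of n]
    proof eventually_elim
      case (elim x)
      have "\<bar>l * X n x\<bar> \<le> l * B"
        using elim assms by (simp add: abs_mult mult_left_mono)
      then have "(l * X n x)\<^sup>2 / 2 * exp \<bar>l * X n x\<bar> \<le> (l * X n x)\<^sup>2 / 2 * exp (l * B)"
        by (intro mult_left_mono) auto
      then show ?case
        using exp_le_quadratic[of "l * X n x"] by (simp add: power_mult_distrib mult.commute mult.left_commute)
    qed
      show "integrable M (\<lambda>x. 1 + l * X n x + l\<^sup>2 * exp (l * B) / 2 * (X n x)\<^sup>2)"
      by (intro Bochner_Integration.integrable_add integrable_mult_right integrable_X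
          integrable_X_square integrable_const)
  qed (use assms in \<open>auto intro!: integrable_exp_X\<close>)
  also have "\<dots> = 1 + l\<^sup>2 * exp (l * B) / 2 * \<sigma>\<^sup>2"
  proof -
    have "integrable M (\<lambda>x. 1 + l * X n x)" "integrable M (\<lambda>x. l * X n x)"
      "integrable M (\<lambda>x. l\<^sup>2 * exp (l * B) / 2 * (X n x)\<^sup>2)"
      by (intro Bochner_Integration.integrable_add integrable_mult_right integrable_X
          integrable_X_square integrable_const)+
    then show ?thesis
      by (subst Bochner_Integration.integral_add) (simp_all add: mean_zero second_moment prob_space)
  qed
  also have "\<dots> \<le> exp (l\<^sup>2 * \<sigma>\<^sup>2 * exp (l * B) / 2)"
    using exp_ge_add_one_self[of "l\<^sup>2 * \<sigma>\<^sup>2 * exp (l * B) / 2"] by (simp add: mult_ac)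
  finally show ?thesis .
qed

text \<open>Convexity with mean zero. It ensures that freezing, which omits factors, cannot push the
  expectation above the power of the unfrozen bound.\<close>

lemma mgf_ge_1:
  assumes "0 \<le> l"
  shows "1 \<le> expectation (\<lambda>x. exp (l * X n x))"
proof -
  have "1 = expectation (\<lambda>x. 1 + l * X n x)"
    by (simp add: integrable_X mean_zero prob_space)
  also have "\<dots> \<le> expectation (\<lambda>x. exp (l * X n x))"
    using exp_ge_add_one_self[of "l * X n x" for x] assms
    by (intro integral_mono) (auto intro!: integrable_exp_X integrable_X)
  finally show ?thesis .
qed

lemma expectation_stopped_exp:
  assumes l: "0 \<le> l" and \<phi>: "\<And>n. expectation (\<lambda>x. exp (l * X n x)) \<le> \<phi>"
  shows "integrable M (\<lambda>x. stopped_exp l y n (\<lambda>i. X i x)) \<and>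
    expectation (\<lambda>x. stopped_exp l y n (\<lambda>i. X i x)) \<le> \<phi> ^ n"
proof (induction n)
  case (Suc n)
  define W where "W n x = stopped_exp l y n (\<lambda>i. X i x)" for n x
  define g where "g x = (if reaches y n x then 0 else stopped_exp l y n x)" for x
  define G where "G x = g (\<lambda>i. X i x)" for x
  define V where "V x = exp (l * X n x) - 1" for x
  have meas: "g \<in> borel_measurable (PiM {..<n} (\<lambda>_. borel))"
    unfolding g_def[abs_def] by (intro measurable_If measurable_reaches[unfolded pred_def] measurable_stopped_exp) auto
  have "indep_var borel (g \<circ> (\<lambda>\<omega>. restrict (\<lambda>i. X i \<omega>) {..<n}))
      borel ((\<lambda>f. exp (l * f n) - 1) \<circ> (\<lambda>\<omega>. restrict (\<lambda>i. X i \<omega>) {n}))"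
    by (intro indep_var_compose[OF indep_var_restrict[OF indep]] meas) auto
  moreover have "g \<circ> (\<lambda>\<omega>. restrict (\<lambda>i. X i \<omega>) {..<n}) = G"
  proof
    fix x
    have "stopped_exp l y n (restrict (\<lambda>i. X i x) {..<n}) = stopped_exp l y n (\<lambda>i. X i x)"
      by (rule stopped_exp_cong) simp
    moreover have "reaches y n (restrict (\<lambda>i. X i x) {..<n}) = reaches y n (\<lambda>i. X i x)"
      by (rule reaches_cong) simp
    ultimately show "(g \<circ> (\<lambda>\<omega>. restrict (\<lambda>i. X i \<omega>) {..<n})) x = G x"
      by (simp add: g_def G_def)
  qed
  moreover have "(\<lambda>f. exp (l * f n) - 1) \<circ> (\<lambda>\<omega>. restrict (\<lambda>i. X i \<omega>) {n}) = V"
    by (simp add: comp_def V_def[abs_def])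
  ultimately have ind: "indep_var borel G borel V"
    by simp
  have W_int: "integrable M (W n)" and W_le: "expectation (W n) \<le> \<phi> ^ n"
    using Suc unfolding W_def by auto
  have W_nonneg: "0 \<le> W n x" and G_nonneg: "0 \<le> G x" and G_le: "G x \<le> W n x" for x
    by (auto simp: W_def G_def g_def stopped_exp_nonneg)
  have G_int: "integrable M G"
  proof (rule Bochner_Integration.integrable_bound[OF W_int])
    show "random_variable borel G"
      using indep_var_rv1[OF ind] .
    show "AE x in M. norm (G x) \<le> norm (W n x)"
      using G_nonneg G_le W_nonneg by simp
  qed
  have V_int: "integrable M V"
    unfolding V_def using integrable_exp_X[OF l, of n] by simp
  have eq: "W (Suc n) = (\<lambda>x. W n x + G x * V x)"
    by (rule ext) (simp add: W_def G_def g_def V_def algebra_simps)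
  have GV_int: "integrable M (\<lambda>x. G x * V x)"
    by (rule indep_var_integrable[OF ind G_int V_int])
  have V_exp: "expectation V = expectation (\<lambda>x. exp (l * X n x)) - 1"
    unfolding V_def using integrable_exp_X[OF l, of n] by (simp add: prob_space)
  have V_bounds: "0 \<le> expectation V" "expectation V \<le> \<phi> - 1"
    unfolding V_exp using mgf_ge_1[OF l, of n] \<phi>[of n] by simp_all
  have "expectation (W (Suc n)) = expectation (W n) + expectation G * expectation V"
    unfolding eq using W_int GV_int
    by (simp add: indep_var_lebesgue_integral[OF ind G_int V_int])
  \<comment> \<open>Replacing \<open>G\<close> by the larger \<open>W n\<close> is allowed because
    \<open>expectation V\<close> is nonnegative.\<close>
  also have "\<dots> \<le> expectation (W n) + expectation (W n) * (\<phi> - 1)"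
    using V_bounds W_int G_int W_nonneg G_le
    by (intro add_left_mono mult_mono integral_mono V_bounds Bochner_Integration.integral_nonneg) auto
  also have "\<dots> = expectation (W n) * \<phi>" by (simp add: algebra_simps)
  also have "\<dots> \<le> \<phi> ^ n * \<phi>"
    using W_le V_bounds by (intro mult_right_mono) auto
  finally have "expectation (W (Suc n)) \<le> \<phi> ^ Suc n" by (simp add: mult.commute)
  moreover have "integrable M (W (Suc n))"
    unfolding eq using W_int GV_int by simp
  ultimately show ?case unfolding W_def by simp
qed (simp add: prob_space)

lemma maximal_inequality:
  fixes n :: nat
  assumes l: "0 \<le> l"
  shows "prob {x \<in> space M. \<exists>j\<le>n. y \<le> S j x} \<le> exp (n * (l\<^sup>2 * \<sigma>\<^sup>2 * exp (l * B) / 2) - l * y)"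
proof -
  let ?W = "\<lambda>x. stopped_exp l y n (\<lambda>i. X i x)"
  let ?\<phi> = "exp (l\<^sup>2 * \<sigma>\<^sup>2 * exp (l * B) / 2)"
  have W: "integrable M ?W" "expectation ?W \<le> ?\<phi> ^ n"
    using expectation_stopped_exp[OF l mgf_le[OF l]] by auto
  have "prob {x \<in> space M. \<exists>j\<le>n. y \<le> S j x} \<le> prob {x \<in> space M. exp (l * y) \<le> ?W x}"
    using borel_measurable_integrable[OF W(1)] stopped_exp_after[OF l, of y n]
    by (intro finite_measure_mono) (auto simp: reaches_def)
  also have "\<dots> \<le> expectation ?W / exp (l * y)"
    by (rule integral_Markov_inequality_measure[where A="{}"])
       (use W(1) in \<open>auto simp: stopped_exp_nonneg\<close>)
  also have "\<dots> \<le> ?\<phi> ^ n / exp (l * y)"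
    using W(2) by (intro divide_right_mono) auto
  also have "\<dots> = exp (n * (l\<^sup>2 * \<sigma>\<^sup>2 * exp (l * B) / 2) - l * y)"
    by (simp add: exp_diff exp_of_nat_mult[symmetric])
  finally show ?thesis .
qed

end

section \<open>The upper half of the law of the iterated logarithm\<close>

text \<open>At \<open>n = 2\<close> the inner logarithm of a logarithm is negative and so is the
  real root; the bound \<open>3 \<le> n\<close> in the lemmas below lies beyond the base of the
  natural logarithm.\<close>

definition lil_scale :: "nat \<Rightarrow> real" where
  "lil_scale n = sqrt (2 * real n * ln (ln (real n)))"

lemma ln_ln_nonneg:
  assumes "3 \<le> (x :: real)"
  shows "0 \<le> ln (ln x)"
proof -
  have "1 \<le> ln (3 :: real)"
    using exp_le by (simp add: ln_ge_iff)
  also have "ln 3 \<le> ln x" using assms by simp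
  finally show ?thesis by simp
qed

lemma lil_scale_square: "3 \<le> n \<Longrightarrow> (lil_scale n)\<^sup>2 = 2 * real n * ln (ln (real n))"
  unfolding lil_scale_def using ln_ln_nonneg[of n] by simp

lemma lil_scale_nonneg: "3 \<le> n \<Longrightarrow> 0 \<le> lil_scale n"
  unfolding lil_scale_def using ln_ln_nonneg[of n] by simp

lemma lil_scale_mono:
  assumes "3 \<le> n" "n \<le> m"
  shows "lil_scale n \<le> lil_scale m"
proof -
  have "1 < real n" using assms by simp
  then have "0 < ln (real n)" "ln (real n) \<le> ln (real m)"
    using assms by simp_all
  then have "ln (ln (real n)) \<le> ln (ln (real m))" by simp
  then show ?thesis
    unfolding lil_scale_def using assms ln_ln_nonneg[of n]
    by (intro real_sqrt_le_mono mult_mono) auto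
qed

lemma lil_scale_pos: "\<forall>\<^sub>F n in sequentially. 0 < lil_scale n"
  unfolding lil_scale_def by real_asymp

lemma lil_scale_over_n: "(\<lambda>n. lil_scale n / real n) \<longlonglongrightarrow> 0"
  unfolding lil_scale_def by real_asymp

text \<open>Take the least \<open>k \<ge> k0\<close> with \<open>n < N (Suc k)\<close>; minimality
  gives \<open>N k \<le> n\<close>, so divergence of \<open>N\<close> suffices in place of
  monotonicity.\<close>

lemma ex_consecutive_bracket:
  fixes N :: "nat \<Rightarrow> nat"
  assumes "filterlim N at_top sequentially" and "N k0 \<le> n"
  shows "\<exists>k\<ge>k0. N k \<le> n \<and> n < N (Suc k)"
proof -
  have "\<forall>\<^sub>F k in sequentially. Suc n \<le> N k"
    using assms(1) unfolding filterlim_at_top by blast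
  then obtain k1 where "\<And>k. k1 \<le> k \<Longrightarrow> Suc n \<le> N k"
    by (auto simp: eventually_sequentially)
  then have ex: "k0 \<le> k0 + k1 \<and> n < N (Suc (k0 + k1))"
    by (simp add: Suc_le_eq)
  define k where "k = (LEAST k. k0 \<le> k \<and> n < N (Suc k))"
  have k: "k0 \<le> k" "n < N (Suc k)"
    using LeastI[of "\<lambda>k. k0 \<le> k \<and> n < N (Suc k)", OF ex] by (auto simp: k_def)
  have "N k \<le> n"
  proof (cases "k = k0")
    case False
    then have "k - 1 < k" "k0 \<le> k - 1" "Suc (k - 1) = k" using k(1) by auto
    then show ?thesis
      using not_less_Least[of "k - 1" "\<lambda>k. k0 \<le> k \<and> n < N (Suc k)"]
      by (auto simp: k_def[symmetric])
  qed (use assms in simp)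
  then show ?thesis using k by blast
qed

section \<open>Geometric times and their asymptotics\<close>

context
  fixes a :: real and N :: "nat \<Rightarrow> nat"
  assumes a: "1 < a"
  defines "N \<equiv> \<lambda>k. nat \<lceil>a ^ k\<rceil>"
begin

lemma geometric_bounds: "a ^ k \<le> real (N k)" "real (N k) \<le> a ^ k + 1"
proof -
  have "0 < a ^ k" using a by simp
  then show "a ^ k \<le> real (N k)" "real (N k) \<le> a ^ k + 1"
    unfolding N_def using of_int_ceiling_le_add_one[of "a ^ k"] by auto
qed

lemma geometric_at_top: "filterlim N at_top sequentially"
proof -
  have "filterlim (\<lambda>k. a ^ k) at_top sequentially" using a by real_asymp
  then have "filterlim (\<lambda>k. real (N k)) at_top sequentially"
    by (rule filterlim_at_top_mono) (simp add: geometric_bounds)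
  then show ?thesis by (simp add: filterlim_sequentially_iff_filterlim_real)
qed

lemma geometric_ratio: "(\<lambda>k. real (N k) / real (N (Suc k))) \<longlonglongrightarrow> 1 / a"
proof (rule tendsto_sandwich)
  have pos: "0 < a ^ k" for k using a by simp
  then have posN: "0 < real (N k)" for k using geometric_bounds(1)[of k] by (meson less_le_trans)
  show "\<forall>\<^sub>F k in sequentially. a ^ k / (a ^ Suc k + 1) \<le> real (N k) / real (N (Suc k))"
    using geometric_bounds posN pos by (intro always_eventually allI frac_le)
      (auto simp: less_imp_le simp del: power_Suc)
  show "\<forall>\<^sub>F k in sequentially. real (N k) / real (N (Suc k)) \<le> (a ^ k + 1) / a ^ Suc k"
    using geometric_bounds posN pos by (intro always_eventually allI frac_le)
      (auto simp: less_imp_le simp del: power_Suc)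
  show "(\<lambda>k. a ^ k / (a ^ Suc k + 1)) \<longlonglongrightarrow> 1 / a" using a by (real_asymp simp add: field_simps)
  show "(\<lambda>k. (a ^ k + 1) / a ^ Suc k) \<longlonglongrightarrow> 1 / a" using a by (real_asymp simp add: field_simps)
qed

text \<open>Up to rounding, the iterated logarithm at \<open>a ^ k\<close> is
  \<open>ln k + ln (ln a)\<close>. This turns the exponentials of the tail bounds into powers of
  \<open>k\<close>.\<close>

lemma geometric_ln_ln: "(\<lambda>k. ln (ln (real (N k))) / ln (real k)) \<longlonglongrightarrow> 1"
proof (rule tendsto_sandwich)
  have ev: "\<forall>\<^sub>F k in sequentially. 1 < a ^ k \<and> 0 < ln (real k)"
  proof (rule eventually_conj)
    show "\<forall>\<^sub>F k in sequentially. 1 < a ^ k" using a by real_asymp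
    show "\<forall>\<^sub>F k in sequentially. 0 < ln (real k)" by real_asymp
  qed
  show "\<forall>\<^sub>F k in sequentially. ln (ln (a ^ k)) / ln (real k) \<le> ln (ln (real (N k))) / ln (real k)"
    using ev
  proof eventually_elim
    case (elim k)
    then have "0 < ln (a ^ k)" "ln (a ^ k) \<le> ln (real (N k))"
      using geometric_bounds(1)[of k] by (auto simp del: ln_realpow)
    then have "ln (ln (a ^ k)) \<le> ln (ln (real (N k)))"
      by (simp del: ln_realpow)
    then show ?case using elim by (intro divide_right_mono) auto
  qed
  show "\<forall>\<^sub>F k in sequentially. ln (ln (real (N k))) / ln (real k) \<le> ln (ln (a ^ k + 1)) / ln (real k)"
    using ev
  proof eventually_elim
    case (elim k)
    then have "1 < real (N k)" using geometric_bounds(1)[of k] by linarith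
    then have "0 < ln (real (N k))" "ln (real (N k)) \<le> ln (a ^ k + 1)"
      using geometric_bounds(2)[of k] by auto
    then have "ln (ln (real (N k))) \<le> ln (ln (a ^ k + 1))"
      by simp
    then show ?case using elim by (intro divide_right_mono) auto
  qed
  show "(\<lambda>k. ln (ln (a ^ k)) / ln (real k)) \<longlonglongrightarrow> 1" using a by real_asymp
  show "(\<lambda>k. ln (ln (a ^ k + 1)) / ln (real k)) \<longlonglongrightarrow> 1" using a by real_asymp
qed

end

context bounded_iid
begin

text \<open>If the bound fails at some \<open>n\<close> between \<open>N k\<close> and
  \<open>N (Suc k)\<close>, then the running maximum up to \<open>N (Suc k)\<close> reaches the
  level \<open>y k\<close> belonging to the smaller time. Using the larger time for the variance
  costs a factor \<open>a\<close> in the exponent, while the factor \<open>a\<close> in the level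
  gains \<open>a\<^sup>2\<close>; the net exponent \<open>a > 1\<close> is summable.\<close>

lemma LIL_upper:
  assumes a: "1 < a"
  shows "AE x in M. \<forall>\<^sub>F n in sequentially. S n x \<le> a * \<sigma> * lil_scale n"
proof -
  define N where "N k = nat \<lceil>a ^ k\<rceil>" for k
  note N = geometric_at_top[OF a, folded N_def[abs_def]] geometric_ratio[OF a, folded N_def]
    geometric_ln_ln[OF a, folded N_def]
  define y where "y k = a * \<sigma> * lil_scale (N k)" for k
  \<comment> \<open>Minimiser in \<open>l\<close> of the exponent of
    \<open>maximal_inequality\<close> at time \<open>N (Suc k)\<close> when the factor
    \<open>exp (l * B)\<close> is replaced by 1.\<close>
  define l where "l k = y k / (real (N (Suc k)) * \<sigma>\<^sup>2)" for k
  define E where "E k = {x \<in> space M. \<exists>j\<le>N (Suc k). y k \<le> S j x}" for k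
  \<comment> \<open>With this \<open>l k\<close> the maximal inequality reads
    \<open>k powr (- R k)\<close>. The three quotient factors and the bracket tend to
    \<open>a\<^sup>2\<close>, \<open>1 / a\<close>, 1 and 1 in turn (the first being constant), so
    \<open>R\<close> eventually exceeds \<open>(1 + a) / 2 > 1\<close>.\<close>
  define R where "R k = a\<^sup>2 * (real (N k) / real (N (Suc k))) *
     (ln (ln (real (N k))) / ln (real k)) * (2 - exp (l k * B))" for k
  have N3: "\<forall>\<^sub>F k in sequentially. 3 \<le> N k"
    using N(1) unfolding filterlim_at_top by blast
  have ratio: "(\<lambda>k. lil_scale (N k) / real (N k)) \<longlonglongrightarrow> 0"
    by (rule filterlim_compose[OF lil_scale_over_n N(1)])
  have "(\<lambda>k. a / \<sigma> * (lil_scale (N k) / real (N k)) * (real (N k) / real (N (Suc k)))) \<longlonglongrightarrow> a / \<sigma> * 0 * (1 / a)"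
    by (intro tendsto_mult tendsto_const ratio N(2))
  moreover have "\<forall>\<^sub>F k in sequentially.
      a / \<sigma> * (lil_scale (N k) / real (N k)) * (real (N k) / real (N (Suc k))) = l k"
    using N3 by eventually_elim (use sigma_pos in \<open>simp add: l_def y_def field_simps power2_eq_square\<close>)
  ultimately have l_lim: "l \<longlonglongrightarrow> 0"
    by (simp add: tendsto_cong)
  have "R \<longlonglongrightarrow> a\<^sup>2 * (1 / a) * 1 * (2 - exp (0 * B))"
    unfolding R_def by (intro tendsto_intros N l_lim)
  then have "R \<longlonglongrightarrow> a" using a by (simp add: power2_eq_square)
  then have R_ev: "\<forall>\<^sub>F k in sequentially. (1 + a) / 2 < R k"
    using a by (intro order_tendstoD) auto
  have E_meas[measurable]: "E k \<in> events" for k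
    unfolding E_def by measurable
  have E_le: "\<forall>\<^sub>F k in sequentially. prob (E k) \<le> real k powr (- ((1 + a) / 2))"
    using R_ev N3 eventually_gt_at_top[of 1] eventually_all_ge_at_top[OF N3]
  proof eventually_elim
    case (elim k)
    have N_pos: "0 < real (N (Suc k))" using elim(4)[rule_format, of "Suc k"] by simp
    have nonneg: "0 \<le> l k"
      using a sigma_pos N_pos lil_scale_nonneg[OF elim(2)]
      unfolding l_def y_def by simp
    have y2: "(y k)\<^sup>2 = a\<^sup>2 * \<sigma>\<^sup>2 * (2 * real (N k) * ln (ln (real (N k))))"
      unfolding y_def using lil_scale_square[OF elim(2)] by (simp add: power_mult_distrib)
    have "prob (E k) \<le> exp (N (Suc k) * ((l k)\<^sup>2 * \<sigma>\<^sup>2 * exp (l k * B) / 2) - l k * y k)"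
      unfolding E_def by (rule maximal_inequality[OF nonneg])
    also have "N (Suc k) * ((l k)\<^sup>2 * \<sigma>\<^sup>2 * exp (l k * B) / 2) - l k * y k =
        - ((y k)\<^sup>2 / (2 * real (N (Suc k)) * \<sigma>\<^sup>2) * (2 - exp (l k * B)))"
    proof -
      have "y k = l k * (real (N (Suc k)) * \<sigma>\<^sup>2)"
        using N_pos sigma_pos by (simp add: l_def)
      then show ?thesis
        using N_pos sigma_pos by (simp add: field_simps power2_eq_square)
    qed
    also have "\<dots> = - (R k * ln (real k))"
      unfolding y2 R_def using N_pos sigma_pos elim(3) by (simp add: field_simps)
    also have "exp \<dots> \<le> exp (- ((1 + a) / 2 * ln (real k)))"
      using elim(1,3) by (intro exp_le_cancel_iff[THEN iffD2] le_imp_neg_le mult_right_mono) auto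
    also have "\<dots> = real k powr (- ((1 + a) / 2))"
      using elim(3) by (simp add: powr_def)
    finally show ?case .
  qed
  have "summable (\<lambda>k. real k powr (- ((1 + a) / 2)))"
    using a by (simp add: summable_real_powr_iff)
  then have "summable (\<lambda>k. prob (E k))"
    by (rule summable_comparison_test_ev[rotated]) (use E_le in \<open>simp\<close>)
  then have "AE x in M. \<forall>\<^sub>F k in sequentially. x \<in> space M - E k"
    by (intro borel_cantelli_AE1) (auto simp: emeasure_eq_measure)
  then show ?thesis
  proof eventually_elim
    case (elim x)
    obtain k0 where k0: "\<And>k. k0 \<le> k \<Longrightarrow> x \<in> space M - E k \<and> 3 \<le> N k"
      using eventually_conj[OF elim N3] by (auto simp: eventually_sequentially)
    show ?case
      using eventually_ge_at_top[of "N k0"]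
    proof eventually_elim
      case (elim n)
      obtain k where k: "k0 \<le> k" "N k \<le> n" "n < N (Suc k)"
        using ex_consecutive_bracket[OF N(1) elim] by blast
      have "S n x < y k"
      proof (rule ccontr)
        assume "\<not> S n x < y k"
        then have "y k \<le> S n x" by (simp only: not_less)
        then have "x \<in> E k"
          using k0[OF k(1)] k(3) unfolding E_def mem_Collect_eq by (meson DiffD1 less_imp_le)
        then show False using k0[OF k(1)] by simp
      qed
      also have "y k \<le> a * \<sigma> * lil_scale n"
        unfolding y_def using k0[OF k(1)] k(2) a sigma_pos
        by (intro mult_left_mono lil_scale_mono) auto
      finally show ?case by simp
    qed
  qed
qed

end

section \<open>The lower half of the law of the iterated logarithm\<close>

text \<open>On the unit interval after \<open>s\<close> the density is at least its value at
  \<open>s + 1\<close>. The crude shift by 1 is of lower order than \<open>s\<^sup>2\<close> in the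
  exponent.\<close>

lemma std_normal_tail_ge:
  assumes "0 \<le> s"
  shows "exp (- (s + 1)\<^sup>2 / 2) / sqrt (2 * pi) \<le> measure std_normal_distribution {s<..}"
proof -
  interpret prob_space std_normal_distribution
    by (rule prob_space_normal_density) simp
  let ?c = "exp (- (s + 1)\<^sup>2 / 2) / sqrt (2 * pi)"
  have "ennreal ?c = (\<integral>\<^sup>+x. ennreal ?c * indicator {s<..s+1} x \<partial>lborel)"
    by (simp add: nn_integral_cmult_indicator)
  also have "\<dots> \<le> (\<integral>\<^sup>+x. ennreal (std_normal_density x) * indicator {s<..} x \<partial>lborel)"
  proof (rule nn_integral_mono)
    fix x :: real
    show "ennreal ?c * indicator {s<..s+1} x \<le> ennreal (std_normal_density x) * indicator {s<..} x"
    proof (cases "x \<in> {s<..s+1}")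
      case True
      then have "x\<^sup>2 \<le> (s + 1)\<^sup>2" using assms by (intro power_mono) auto
      then have "?c \<le> std_normal_density x"
        by (simp add: std_normal_density_def divide_right_mono)
      then show ?thesis using True by (simp add: ennreal_leI)
    qed simp
  qed
  also have "\<dots> = emeasure std_normal_distribution {s<..}"
    by (simp add: emeasure_density)
  finally show ?thesis
    by (simp add: emeasure_eq_measure)
qed

lemma isCont_cdf_std_normal: "isCont (cdf std_normal_distribution) x"
proof -
  interpret real_distribution std_normal_distribution by (rule real_dist_normal_dist)
  have "emeasure std_normal_distribution {x} = 0"
    by (subst emeasure_density) (auto intro!: nn_integral_null_set)
  then show ?thesis
    unfolding isCont_cdf by (simp add: measure_def)
qed

section \<open>Central limit theorem and independent blocks\<close>

context bounded_iid
begin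

lemma clt: "weak_conv_m (\<lambda>n. distr M borel (\<lambda>x. S n x / sqrt (n * \<sigma>\<^sup>2))) std_normal_distribution"
  by (rule central_limit_theorem_zero_mean[OF indep mean_zero sigma_pos integrable_X_square _ ident])
     (simp add: mean_zero second_moment)

lemma clt_cdf:
  "(\<lambda>n. prob {x \<in> space M. S n x \<le> s * (\<sigma> * sqrt n)}) \<longlonglongrightarrow> cdf std_normal_distribution s"
proof -
  have "(\<lambda>n. cdf (distr M borel (\<lambda>x. S n x / sqrt (n * \<sigma>\<^sup>2))) s) \<longlonglongrightarrow> cdf std_normal_distribution s"
    using clt isCont_cdf_std_normal unfolding weak_conv_m_def weak_conv_def by blast
  moreover have "\<forall>\<^sub>F n in sequentially. cdf (distr M borel (\<lambda>x. S n x / sqrt (n * \<sigma>\<^sup>2))) s =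
      prob {x \<in> space M. S n x \<le> s * (\<sigma> * sqrt n)}"
    using eventually_gt_at_top[of 0]
  proof eventually_elim
    case (elim n)
    have "cdf (distr M borel (\<lambda>x. S n x / sqrt (n * \<sigma>\<^sup>2))) s =
        prob ((\<lambda>x. S n x / sqrt (n * \<sigma>\<^sup>2)) -` {..s} \<inter> space M)"
      unfolding cdf_def by (subst measure_distr) auto
    also have "(\<lambda>x. S n x / sqrt (n * \<sigma>\<^sup>2)) -` {..s} \<inter> space M = {x \<in> space M. S n x \<le> s * (\<sigma> * sqrt n)}"
      using elim sigma_pos by (auto simp: real_sqrt_mult field_simps)
    finally show ?case .
  qed
  ultimately show ?thesis by (rule Lim_transform_eventually)
qed

lemma clt_tail:
  "(\<lambda>n. prob {x \<in> space M. s * (\<sigma> * sqrt n) < S n x}) \<longlonglongrightarrow> measure std_normal_distribution {s<..}"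
proof -
  interpret N: real_distribution std_normal_distribution by (rule real_dist_normal_dist)
  have "(\<lambda>n. 1 - prob {x \<in> space M. S n x \<le> s * (\<sigma> * sqrt n)}) \<longlonglongrightarrow> 1 - cdf std_normal_distribution s"
    by (intro tendsto_intros clt_cdf)
  moreover have "1 - prob {x \<in> space M. S n x \<le> s * (\<sigma> * sqrt n)} =
      prob {x \<in> space M. s * (\<sigma> * sqrt n) < S n x}" for n
    by (subst prob_compl[symmetric]) (auto intro!: arg_cong[where f=prob])
  moreover have "1 - cdf std_normal_distribution s = measure std_normal_distribution {s<..}"
  proof -
    have "UNIV - {..s} = {s<..}" by auto
    then show ?thesis unfolding cdf_def using N.prob_compl[of "{..s}"] by simp
  qed
  ultimately show ?thesis by simp
qed

text \<open>The characteristic function of a sum over \<open>I\<close> is a power with exponent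
  \<open>card I\<close>, so by uniqueness its law depends on the size of \<open>I\<close> alone.
  This replaces shift invariance of the sequence.\<close>

lemma prob_block_sum_ge:
  assumes "finite I"
  shows "prob {x \<in> space M. y \<le> (\<Sum>i\<in>I. X i x)} = prob {x \<in> space M. y \<le> S (card I) x}"
proof -
  have "char (distr M borel (\<lambda>x. \<Sum>i\<in>J. X i x)) t = char (distr M borel (X 0)) t ^ card J"
    for J :: "nat set" and t
  proof -
    have "char (distr M borel (\<lambda>x. \<Sum>i\<in>J. X i x)) t = (\<Prod>i\<in>J. char (distr M borel (X i)) t)"
      by (rule char_distr_sum[OF indep_vars_subset[OF indep subset_UNIV]])
    also have "\<dots> = (\<Prod>i\<in>J. char (distr M borel (X 0)) t)"
      by (intro prod.cong refl) (subst ident, rule refl)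
    finally show ?thesis by simp
  qed
  then have eq: "distr M borel (\<lambda>x. \<Sum>i\<in>I. X i x) = distr M borel (S (card I))"
    by (intro Levy_uniqueness) (auto simp: fun_eq_iff)
  have "prob {x \<in> space M. y \<le> (\<Sum>i\<in>J. X i x)} = measure (distr M borel (\<lambda>x. \<Sum>i\<in>J. X i x)) {y..}"
    for J :: "nat set"
    by (subst measure_distr) (auto intro!: arg_cong[where f=prob])
  then show ?thesis using eq by simp
qed

text \<open>A sum of n terms is large as soon as m consecutive blocks of length l all are.\<close>

lemma prob_ge_blocks:
  assumes "0 < m" and "m * l \<le> n"
  shows "prob {x \<in> space M. y \<le> S l x} ^ m \<le> prob {x \<in> space M. m * y - B * real (n - m * l) \<le> S n x}"
proof -
  define Z where "Z j x = (\<Sum>i\<in>{j*l..<j*l+l}. X i x)" for j x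
  have disj: "disjoint_family_on (\<lambda>j. {j*l..<j*l+l}) {..<m}"
  proof (unfold disjoint_family_on_def, safe)
    fix i j k assume "i \<noteq> j" and k: "k \<in> {i*l..<i*l+l}" "k \<in> {j*l..<j*l+l}"
    have "i = k div l" "j = k div l" using k
      by (auto intro!: div_nat_eqI[symmetric] simp: mult.commute)
    with \<open>i \<noteq> j\<close> show "k \<in> {}" by simp
  qed
  have indZ: "indep_vars (\<lambda>_. borel) Z {..<m}"
    unfolding Z_def by (rule indep_vars_block_sums[OF indep _ disj]) simp
  have [measurable]: "random_variable borel (Z j)" for j
    unfolding Z_def by measurable
  have "prob {x \<in> space M. y \<le> S l x} ^ m = (\<Prod>j<m. prob (Z j -` {y..} \<inter> space M))"
  proof -
    have "Z j -` {y..} \<inter> space M = {x \<in> space M. y \<le> Z j x}" for j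
      by auto
    then have "prob (Z j -` {y..} \<inter> space M) = prob {x \<in> space M. y \<le> S l x}" for j
      unfolding Z_def using prob_block_sum_ge[of "{j*l..<j*l+l}" y] by simp
    then show ?thesis by simp
  qed
  also have "\<dots> = prob (\<Inter>j<m. Z j -` {y..} \<inter> space M)"
    using assms(1) by (intro indep_varsD_finite[OF indZ, symmetric]) auto
  also have "\<dots> \<le> prob {x \<in> space M. m * y - B * real (n - m * l) \<le> S n x}"
  proof (rule finite_measure_mono_AE)
    have "AE x in M. \<forall>i. \<bar>X i x\<bar> \<le> B" using bounded by (simp add: AE_all_countable)
    then show "AE x in M. x \<in> (\<Inter>j<m. Z j -` {y..} \<inter> space M) \<longrightarrow>
        x \<in> {x \<in> space M. m * y - B * real (n - m * l) \<le> S n x}"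
    proof eventually_elim
      case (elim x)
      show ?case
      proof
        assume x: "x \<in> (\<Inter>j<m. Z j -` {y..} \<inter> space M)"
        have Z_ge: "y \<le> Z j x" if "j < m" for j
          using x that by (simp only: INT_iff Int_iff vimage_eq atLeast_iff lessThan_iff)
        have "S n x = (\<Sum>i<m * l. X i x) + (\<Sum>i\<in>{m*l..<n}. X i x)"
          using assms sum.atLeastLessThan_concat[of 0 "m*l" n "\<lambda>i. X i x"]
          by (simp add: atLeast0LessThan)
        also have "(\<Sum>i<m * l. X i x) = (\<Sum>j<m. Z j x)"
          unfolding Z_def by (rule sum.nat_group[symmetric])
        finally have "S n x = (\<Sum>j<m. Z j x) + (\<Sum>i\<in>{m*l..<n}. X i x)" .
        moreover have "(\<Sum>j<m. y) \<le> (\<Sum>j<m. Z j x)"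
          using Z_ge by (intro sum_mono) auto
        \<comment> \<open>The last \<open>n - m * l\<close> terms belong to no block; each of them
          lowers the sum by at most \<open>B\<close>.\<close>
        moreover have "- B \<le> X i x" for i using elim[rule_format, of i] by linarith
        then have "(\<Sum>i\<in>{m*l..<n}. - B) \<le> (\<Sum>i\<in>{m*l..<n}. X i x)" by (intro sum_mono)
        moreover have "x \<in> space M" using x assms(1) by (metis INT_E Int_iff lessThan_iff)
        ultimately show "x \<in> {x \<in> space M. m * y - B * real (n - m * l) \<le> S n x}"
          using assms by (simp add: algebra_simps of_nat_diff)
      qed
    qed
  qed measurable
  finally show ?thesis .
qed

end

lemma limsup_ereal_eqI:
  fixes f :: "nat \<Rightarrow> real"
  assumes upper: "\<And>a. s < a \<Longrightarrow> \<forall>\<^sub>F n in sequentially. f n \<le> a"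
    and lower: "\<And>a. a < s \<Longrightarrow> \<exists>\<^sub>F n in sequentially. a \<le> f n"
  shows "limsup (\<lambda>n. ereal (f n)) = ereal s"
proof (rule antisym)
  show "limsup (\<lambda>n. ereal (f n)) \<le> ereal s"
    unfolding Limsup_le_iff
  proof (intro allI impI)
    fix y assume "ereal s < y"
    then obtain a where a: "ereal s < ereal a" "ereal a < y" using ereal_dense2 by blast
    then have "\<forall>\<^sub>F n in sequentially. f n \<le> a" by (intro upper) simp
    then show "\<forall>\<^sub>F n in sequentially. ereal (f n) < y"
      by eventually_elim (use a(2) in \<open>meson ereal_less_eq(3) le_less_trans\<close>)
  qed
  show "ereal s \<le> limsup (\<lambda>n. ereal (f n))"
  proof (rule ccontr)
    assume "\<not> ereal s \<le> limsup (\<lambda>n. ereal (f n))"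
    then obtain a where a: "limsup (\<lambda>n. ereal (f n)) < ereal a" "ereal a < ereal s"
      using ereal_dense2 by (meson not_le)
    then have "\<forall>\<^sub>F n in sequentially. ereal (f n) < ereal a" by (intro Limsup_lessD)
    moreover have "\<exists>\<^sub>F n in sequentially. a \<le> f n" using a by (intro lower) simp
    ultimately show False by (simp add: frequently_def not_le)
  qed
qed

lemma frequently_compose_filterlim:
  "\<exists>\<^sub>F k in F. P (f k) \<Longrightarrow> filterlim f G F \<Longrightarrow> \<exists>\<^sub>F n in G. P n"
  unfolding frequently_def using eventually_compose_filterlim[of "\<lambda>n. \<not> P n" G f F] by blast

lemma disjoint_family_power_blocks:
  fixes m :: nat
  assumes "0 < m"
  shows "disjoint_family (\<lambda>k. {m ^ k..<m ^ Suc k})"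
proof -
  have "{m ^ i..<m ^ Suc i} \<inter> {m ^ j..<m ^ Suc j} = {}" if "i < j" for i j
  proof -
    have "m ^ Suc i \<le> m ^ j" using assms that by (intro power_increasing) auto
    then show ?thesis by auto
  qed
  then show ?thesis
    unfolding disjoint_family_on_def by (metis Int_commute linorder_neqE_nat)
qed

text \<open>The iterated logarithm only grows, so the ratio of scales is at most that of the square
  roots. For large \<open>m\<close> the past is therefore negligible at time
  \<open>m ^ Suc k\<close>.\<close>

lemma lil_scale_power_le:
  fixes m k :: nat
  assumes "2 \<le> m" "3 \<le> m ^ k"
  shows "lil_scale (m ^ k) \<le> lil_scale (m ^ Suc k) / sqrt m"
proof -
  have "m ^ k \<le> m ^ Suc k" using assms by (intro power_increasing) auto
  then have "ln (real (m ^ k)) \<le> ln (real (m ^ Suc k))" and "0 < ln (real (m ^ k))"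
    using assms by (simp_all del: of_nat_power power_Suc)
  then have "ln (ln (real (m ^ k))) \<le> ln (ln (real (m ^ Suc k)))"
    by (simp del: of_nat_power power_Suc ln_realpow)
  then have "2 * real (m ^ k) * ln (ln (real (m ^ k))) \<le> 2 * real (m ^ k) * ln (ln (real (m ^ Suc k)))"
    by (intro mult_left_mono) auto
  also have "\<dots> = (2 * real (m ^ Suc k) * ln (ln (real (m ^ Suc k)))) / m"
    using assms by simp
  finally show ?thesis
    unfolding lil_scale_def by (simp only: real_sqrt_divide[symmetric] real_sqrt_le_iff)
qed

section \<open>Lower exponential bound and lower law of the iterated logarithm\<close>

context bounded_iid
begin

lemma uminus_bounded_iid: "bounded_iid M (\<lambda>n x. - X n x) B \<sigma>"
proof
  show "indep_vars (\<lambda>_. borel) (\<lambda>n x. - X n x) UNIV"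
    by (rule indep_vars_compose2[OF indep, where Y="\<lambda>_ x. - x"]) simp
  show "distr M borel (\<lambda>x. - X n x) = distr M borel (\<lambda>x. - X 0 x)" for n
  proof -
    have "distr M borel (\<lambda>x. - X k x) = distr (distr M borel (X k)) borel uminus" for k
      by (subst distr_distr) (auto simp: comp_def)
    then show ?thesis using ident[of n] by metis
  qed
qed (use bounded sigma_pos in \<open>auto simp: mean_zero second_moment\<close>)

text \<open>A converse to the exponential upper bound in the moderate range, where \<open>u\<close>
  diverges but is small against the root of \<open>n\<close>. Each block pays about
  \<open>exp (- t\<^sup>2 / 2)\<close>, and about \<open>u\<^sup>2 / t\<^sup>2\<close> blocks
  together pay about \<open>exp (- u\<^sup>2 / 2)\<close>, up to the slack between
  \<open>c\<^sup>2\<close> and \<open>\<gamma>\<close>.\<close>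

lemma lower_tail:
  fixes n :: "nat \<Rightarrow> nat" and u :: "nat \<Rightarrow> real"
  assumes c: "0 < c" "c\<^sup>2 < \<gamma>"
    and n: "filterlim n at_top sequentially" and u: "filterlim u at_top sequentially"
    and un: "(\<lambda>k. u k / sqrt (n k)) \<longlonglongrightarrow> 0"
  shows "\<forall>\<^sub>F k in sequentially. exp (- \<gamma> * (u k)\<^sup>2 / 2)
     \<le> prob {x \<in> space M. c * \<sigma> * sqrt (n k) * u k \<le> S (n k) x}"
proof -
  \<comment> \<open>The slack is divided in three. The gap from \<open>c\<close> to \<open>d\<close>
    covers block lengths rounded down and terms outside the blocks; from \<open>d\<^sup>2\<close> to
    \<open>g\<close>, the shift by 1 and the factor \<open>sqrt (2 * pi)\<close> in the normal tail,
    for a large fixed \<open>t\<close>; from \<open>g\<close> to \<open>\<gamma>\<close>, the number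
    of blocks rounded up.\<close>
  have "c < sqrt \<gamma>" using c by (intro real_less_rsqrt) auto
  then obtain d where d: "c < d" "d < sqrt \<gamma>" using dense by blast
  have d2: "d\<^sup>2 < \<gamma>"
    using d c power_strict_mono[of d "sqrt \<gamma>" 2] le_less_trans[OF zero_le_power2 c(2)] by simp
  then obtain g where g: "d\<^sup>2 < g" "g < \<gamma>" using dense by blast
  have d_pos: "0 < d" and g_pos: "0 < g" using d c g by (auto intro: le_less_trans[OF zero_le_power2])
  have "\<forall>\<^sub>F t in at_top. 0 < t \<and> exp (- g * t\<^sup>2 / 2) < exp (- (d * t + 1)\<^sup>2 / 2) / sqrt (2 * pi)"
  proof (rule eventually_conj)
    define \<delta> where "\<delta> = g - d\<^sup>2"
    have "0 < \<delta>" using g by (simp add: \<delta>_def)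
    then have "\<forall>\<^sub>F t in at_top. 0 < \<delta> * t\<^sup>2 / 2 - d * t - 1 / 2 - ln (sqrt (2 * pi))"
      by real_asymp
    then show "\<forall>\<^sub>F t in at_top. exp (- g * t\<^sup>2 / 2) < exp (- (d * t + 1)\<^sup>2 / 2) / sqrt (2 * pi)"
    proof eventually_elim
      case (elim t)
      have "- g * t\<^sup>2 / 2 < - (d * t + 1)\<^sup>2 / 2 - ln (sqrt (2 * pi))"
        using elim by (simp add: \<delta>_def power2_eq_square algebra_simps)
      then have "exp (- g * t\<^sup>2 / 2) < exp (- (d * t + 1)\<^sup>2 / 2 - ln (sqrt (2 * pi)))"
        by (simp only: exp_less_cancel_iff)
      then show ?case by (simp add: exp_diff)
    qed
  qed (rule eventually_gt_at_top)
  then obtain t where t: "0 < t"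
    "exp (- g * t\<^sup>2 / 2) < exp (- (d * t + 1)\<^sup>2 / 2) / sqrt (2 * pi)"
    using eventually_happens[of _ "at_top :: real filter"] by auto
  then have "exp (- g * t\<^sup>2 / 2) < measure std_normal_distribution {d * t<..}"
    using std_normal_tail_ge[of "d * t"] d_pos by simp
  then have block: "\<forall>\<^sub>F l in sequentially. exp (- g * t\<^sup>2 / 2) < prob {x \<in> space M. d * t * (\<sigma> * sqrt l) < S l x}"
    by (rule order_tendstoD(1)[OF clt_tail])

  \<comment> \<open>With about \<open>u\<^sup>2 / t\<^sup>2\<close> blocks, a block has standard
    deviation close to \<open>\<sigma> * t * sqrt n / u\<close>. If every block exceeds
    \<open>d * t\<close> of these, the total is close to
    \<open>d * \<sigma> * sqrt n * u\<close>.\<close>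
  define m where "m k = nat \<lceil>(u k)\<^sup>2 / t\<^sup>2\<rceil>" for k
  define l where "l k = n k div m k" for k
  have m_bounds: "(u k)\<^sup>2 / t\<^sup>2 \<le> real (m k)" "real (m k) \<le> (u k)\<^sup>2 / t\<^sup>2 + 1" for k
  proof -
    have "0 \<le> (u k)\<^sup>2 / t\<^sup>2" by simp
    then show "(u k)\<^sup>2 / t\<^sup>2 \<le> real (m k)" "real (m k) \<le> (u k)\<^sup>2 / t\<^sup>2 + 1"
      unfolding m_def using of_int_ceiling_le_add_one[of "(u k)\<^sup>2 / t\<^sup>2"] by linarith+
  qed
  have u_ev: "\<forall>\<^sub>F k in sequentially. 0 < u k"
    using u unfolding filterlim_at_top_dense by blast
  have n_ev: "\<forall>\<^sub>F k in sequentially. 0 < n k"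
    by (rule eventually_compose_filterlim[OF eventually_gt_at_top n])
  have n_real: "filterlim (\<lambda>k. real (n k)) at_top sequentially"
    using filterlim_compose[OF filterlim_real_sequentially n] .
  \<comment> \<open>Here \<open>u\<close> being small against the root of \<open>n\<close> matters:
    the block lengths tend to infinity, so the estimate \<open>block\<close> applies to
    them.\<close>
  have m_n: "(\<lambda>k. real (m k) / real (n k)) \<longlonglongrightarrow> 0"
  proof (rule tendsto_sandwich[where f="\<lambda>_. 0"])
    have "(\<lambda>k. (u k / sqrt (n k))\<^sup>2 / t\<^sup>2 + inverse (real (n k))) \<longlonglongrightarrow> 0\<^sup>2 / t\<^sup>2 + 0"
      using t(1) by (intro tendsto_intros un tendsto_inverse_0_at_top n_real) auto
    then show "(\<lambda>k. (u k / sqrt (n k))\<^sup>2 / t\<^sup>2 + inverse (real (n k))) \<longlonglongrightarrow> 0" by simp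
    show "\<forall>\<^sub>F k in sequentially. real (m k) / real (n k) \<le> (u k / sqrt (n k))\<^sup>2 / t\<^sup>2 + inverse (real (n k))"
      using n_ev
    proof eventually_elim
      case (elim k)
      have "real (m k) / real (n k) \<le> ((u k)\<^sup>2 / t\<^sup>2 + 1) / real (n k)"
        using m_bounds(2)[of k] by (intro divide_right_mono) auto
      also have "\<dots> = (u k / sqrt (n k))\<^sup>2 / t\<^sup>2 + inverse (real (n k))"
        by (simp add: power_divide add_divide_distrib inverse_eq_divide)
      finally show ?case .
    qed
  qed auto
  \<comment> \<open>Fewer than \<open>m k\<close> terms lie outside the blocks, at a cost of at most
    \<open>B * m k\<close>; this is negligible against a level of order
    \<open>sqrt (n k) * u k\<close>.\<close>
  have m_nu: "(\<lambda>k. real (m k) / (sqrt (n k) * u k)) \<longlonglongrightarrow> 0"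
  proof (rule tendsto_sandwich[where f="\<lambda>_. 0"])
    have "filterlim (\<lambda>k. sqrt (n k) * u k) at_top sequentially"
      by (intro filterlim_at_top_mult_at_top u filterlim_compose[OF sqrt_at_top n_real])
    then have "(\<lambda>k. u k / sqrt (n k) / t\<^sup>2 + inverse (sqrt (n k) * u k)) \<longlonglongrightarrow> 0 / t\<^sup>2 + 0"
      using t(1) by (intro tendsto_intros un tendsto_inverse_0_at_top) auto
    then show "(\<lambda>k. u k / sqrt (n k) / t\<^sup>2 + inverse (sqrt (n k) * u k)) \<longlonglongrightarrow> 0" by simp
    show "\<forall>\<^sub>F k in sequentially. 0 \<le> real (m k) / (sqrt (n k) * u k)"
      using u_ev by eventually_elim simp
    show "\<forall>\<^sub>F k in sequentially. real (m k) / (sqrt (n k) * u k)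
        \<le> u k / sqrt (n k) / t\<^sup>2 + inverse (sqrt (n k) * u k)"
      using n_ev u_ev
    proof eventually_elim
      case (elim k)
      have "real (m k) / (sqrt (n k) * u k) \<le> ((u k)\<^sup>2 / t\<^sup>2 + 1) / (sqrt (n k) * u k)"
        using m_bounds(2)[of k] elim by (intro divide_right_mono) auto
      also have "\<dots> = u k / sqrt (n k) / t\<^sup>2 + inverse (sqrt (n k) * u k)"
        using elim t(1) by (simp add: field_simps power2_eq_square)
      finally show ?case .
    qed
  qed auto
  have m_pos: "\<forall>\<^sub>F k in sequentially. 0 < m k"
    using u_ev
  proof eventually_elim
    case (elim k)
    then have "0 < (u k)\<^sup>2 / t\<^sup>2" using t(1) by simp
    then show ?case using m_bounds(1)[of k] by linarith
  qed
  have "filterlim (\<lambda>k. real (n k) / real (m k) - 1) at_top sequentially"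
  proof -
    have "filterlim (\<lambda>k. inverse (real (m k) / real (n k))) at_top sequentially"
      using m_pos n_ev
      by (intro filterlim_inverse_at_top m_n) (auto elim: eventually_elim2)
    then have "filterlim (\<lambda>k. - 1 + real (n k) / real (m k)) at_top sequentially"
      by (intro filterlim_tendsto_add_at_top[OF tendsto_const]) (simp add: inverse_eq_divide)
    then show ?thesis by simp
  qed
  then have "filterlim (\<lambda>k. real (l k)) at_top sequentially"
  proof (rule filterlim_at_top_mono)
    show "\<forall>\<^sub>F k in sequentially. real (n k) / real (m k) - 1 \<le> real (l k)"
    proof (intro always_eventually allI)
      fix k
      have "real (l k) = real_of_int \<lfloor>real (n k) / real (m k)\<rfloor>"
        by (simp add: l_def floor_divide_of_nat_eq)
      then show "real (n k) / real (m k) - 1 \<le> real (l k)"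
        by linarith
    qed
  qed
  then have l_lim: "filterlim l at_top sequentially"
    by (simp add: filterlim_sequentially_iff_filterlim_real)
  have "(\<lambda>k. d * \<sigma> * sqrt (1 - real (m k) / real (n k)) - B * (real (m k) / (sqrt (n k) * u k)))
      \<longlonglongrightarrow> d * \<sigma> * sqrt (1 - 0) - B * 0"
    by (intro tendsto_intros m_n m_nu)
  then have threshold: "\<forall>\<^sub>F k in sequentially. c * \<sigma>
      < d * \<sigma> * sqrt (1 - real (m k) / real (n k)) - B * (real (m k) / (sqrt (n k) * u k))"
    using d sigma_pos by (intro order_tendstoD(1)) auto
  have "filterlim (\<lambda>k. (\<gamma> - g) * (u k)\<^sup>2) at_top sequentially"
    using g by (intro filterlim_tendsto_pos_mult_at_top[OF tendsto_const] filterlim_pow_at_top u) auto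
  then have rate: "\<forall>\<^sub>F k in sequentially. g * t\<^sup>2 \<le> (\<gamma> - g) * (u k)\<^sup>2"
    unfolding filterlim_at_top by blast
  have block': "\<forall>\<^sub>F k in sequentially. exp (- g * t\<^sup>2 / 2)
      < prob {x \<in> space M. d * t * (\<sigma> * sqrt (l k)) < S (l k) x}"
    by (rule eventually_compose_filterlim[OF block l_lim])
  show ?thesis
    using block' rate threshold m_pos u_ev n_ev
  proof eventually_elim
    case (elim k)
    let ?y = "d * t * (\<sigma> * sqrt (l k))"
    have ml: "m k * l k \<le> n k" by (simp add: l_def)
    have rest: "real (n k - m k * l k) \<le> real (m k)"
    proof -
      have "n k - m k * l k = n k mod m k" by (simp add: l_def minus_mult_div_eq_mod)
      then show ?thesis using elim(4) by (simp add: less_imp_le)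
    qed
    have "exp (- \<gamma> * (u k)\<^sup>2 / 2) \<le> exp (- g * t\<^sup>2 / 2) ^ m k"
    proof -
      have "g * t\<^sup>2 * real (m k) \<le> g * t\<^sup>2 * ((u k)\<^sup>2 / t\<^sup>2 + 1)"
        using m_bounds(2)[of k] g_pos by (intro mult_left_mono) auto
      also have "\<dots> = g * (u k)\<^sup>2 + g * t\<^sup>2" using t(1) by (simp add: field_simps)
      also have "\<dots> \<le> \<gamma> * (u k)\<^sup>2" using elim(2) by (simp add: algebra_simps)
      finally show ?thesis by (simp add: exp_of_nat_mult[symmetric] algebra_simps)
    qed
    also have "\<dots> \<le> prob {x \<in> space M. ?y \<le> S (l k) x} ^ m k"
    proof (rule power_mono)
      have "exp (- g * t\<^sup>2 / 2) \<le> prob {x \<in> space M. ?y < S (l k) x}" using elim(1) by simp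
      also have "\<dots> \<le> prob {x \<in> space M. ?y \<le> S (l k) x}"
        by (intro finite_measure_mono) auto
      finally show "exp (- g * t\<^sup>2 / 2) \<le> prob {x \<in> space M. ?y \<le> S (l k) x}" .
    qed simp
    also have "\<dots> \<le> prob {x \<in> space M. real (m k) * ?y - B * real (n k - m k * l k) \<le> S (n k) x}"
      by (rule prob_ge_blocks[OF elim(4) ml])
    also have "\<dots> \<le> prob {x \<in> space M. c * \<sigma> * sqrt (n k) * u k \<le> S (n k) x}"
    proof -
      \<comment> \<open>The blocks cover at least \<open>n k - m k\<close> terms and
        \<open>u k \<le> sqrt (m k) * t\<close>; the factor \<open>sqrt (1 - m k / n k)\<close> is
        the price of rounding \<open>n k div m k\<close> down.\<close>
      have "sqrt (1 - real (m k) / real (n k)) * (sqrt (n k) * u k) \<le> real (m k) * t * sqrt (l k)"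
      proof -
        have mn: "real (n k) - real (m k) \<le> real (m k) * real (l k)"
          using rest ml by (simp add: of_nat_diff)
        have "u k \<le> sqrt (real (m k)) * t"
        proof -
          have "(u k)\<^sup>2 \<le> real (m k) * t\<^sup>2" using m_bounds(1)[of k] t(1) by (simp add: field_simps)
          then have "sqrt ((u k)\<^sup>2) \<le> sqrt (real (m k) * t\<^sup>2)" by (simp only: real_sqrt_le_iff)
          then show ?thesis using elim(5) t(1) by (simp add: real_sqrt_mult)
        qed
        moreover have "sqrt (1 - real (m k) / real (n k)) * sqrt (n k) = sqrt (real (n k) - real (m k))"
          using elim(6) by (simp add: real_sqrt_mult[symmetric] field_simps)
        moreover have "sqrt (real (n k) - real (m k)) \<le> sqrt (real (m k)) * sqrt (real (l k))"
          using mn by (simp only: real_sqrt_mult[symmetric] real_sqrt_le_iff)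
        ultimately have "sqrt (1 - real (m k) / real (n k)) * sqrt (n k) * u k
            \<le> sqrt (real (m k)) * sqrt (real (l k)) * (sqrt (real (m k)) * t)"
          using elim(5)
          by (intro mult_mono[where a="sqrt (1 - real (m k) / real (n k)) * sqrt (n k)"
                and b="sqrt (real (m k)) * sqrt (real (l k))"]) auto
        also have "\<dots> = real (m k) * t * sqrt (l k)"
          using real_sqrt_mult_self[of "real (m k)"] by (simp add: algebra_simps)
        finally show ?thesis by (simp add: mult.assoc)
      qed
      then have "d * \<sigma> * (sqrt (1 - real (m k) / real (n k)) * (sqrt (n k) * u k))
          \<le> d * \<sigma> * (real (m k) * t * sqrt (l k))"
        using d_pos sigma_pos by (intro mult_left_mono) auto
      moreover have "c * \<sigma> * (sqrt (n k) * u k) \<le>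
          (d * \<sigma> * sqrt (1 - real (m k) / real (n k)) - B * (real (m k) / (sqrt (n k) * u k))) * (sqrt (n k) * u k)"
        using elim by (intro mult_right_mono) auto
      moreover have "B * (real (m k) / (sqrt (n k) * u k)) * (sqrt (n k) * u k) = B * real (m k)"
        using elim by simp
      moreover have "B * real (n k - m k * l k) \<le> B * real (m k)"
        using rest B_nonneg by (rule mult_left_mono)
      ultimately have "c * \<sigma> * sqrt (n k) * u k \<le> real (m k) * ?y - B * real (n k - m k * l k)"
        by (simp add: algebra_simps)
      then show ?thesis by (intro finite_measure_mono) (auto intro: order_trans)
    qed
    finally show ?case .
  qed
qed

text \<open>Disjoint increments between powers of \<open>m\<close> are independent and exceed
  \<open>d\<close> times the scale infinitely often; the gap \<open>d - a\<close> pays for the sum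
  before the increment. Both demands on \<open>m\<close>, that \<open>c\<^sup>2 < 1\<close> and that
  \<open>2 / sqrt m < d - a\<close>, hold once \<open>m\<close> is large.\<close>

lemma LIL_lower:
  assumes a: "0 < a" "a < 1"
  shows "AE x in M. \<exists>\<^sub>F n in sequentially. a * \<sigma> * lil_scale n \<le> S n x"
proof -
  obtain d where d: "a < d" "d < 1" using a(2) dense by blast
  have "(\<lambda>m. d\<^sup>2 * (real m / (real m - 1))) \<longlonglongrightarrow> d\<^sup>2 * 1"
    by (intro tendsto_intros) real_asymp
  moreover have "d\<^sup>2 < 1" using a d by (simp add: power_less_one_iff)
  ultimately have ev1: "\<forall>\<^sub>F m in sequentially. d\<^sup>2 * (real m / (real m - 1)) < 1"
    by (intro order_tendstoD(2)) auto
  have ev2: "\<forall>\<^sub>F m in sequentially. 2 / sqrt (real m) < d - a"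
  proof (rule order_tendstoD(2))
    show "(\<lambda>m. 2 / sqrt (real m)) \<longlonglongrightarrow> 0" by real_asymp
  qed (use d in simp)
  have "\<forall>\<^sub>F m in sequentially. d\<^sup>2 * (real m / (real m - 1)) < 1 \<and> 2 / sqrt (real m) < d - a \<and> 2 \<le> m"
    using ev1 ev2 eventually_ge_at_top[of "2::nat"] by eventually_elim simp
  then obtain m :: nat where m: "d\<^sup>2 * (real m / (real m - 1)) < 1" "2 / sqrt (real m) < d - a" "2 \<le> m"
    by (auto simp: eventually_sequentially)
  \<comment> \<open>The level \<open>y k\<close> is scaled by \<open>m ^ Suc k\<close>, while the
    increment has only \<open>m ^ Suc k - m ^ k\<close> terms; the root converts one normalisation
    into the other.\<close>
  define c where "c = d * sqrt (real m / (real m - 1))"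
  have c: "0 < c" "c\<^sup>2 < 1"
    using a d m by (auto simp: c_def power_mult_distrib)
  then obtain \<gamma> where \<gamma>: "c\<^sup>2 < \<gamma>" "\<gamma> < 1" using dense by blast
  define n where "n k = m ^ Suc k - m ^ k" for k
  \<comment> \<open>Half the square of \<open>u k\<close> is the iterated logarithm at
    \<open>m ^ Suc k\<close>, so \<open>lower_tail\<close> yields a constant times
    \<open>Suc k powr - \<gamma>\<close>, whose series diverges because
    \<open>\<gamma> < 1\<close>.\<close>
  define u where "u k = sqrt (2 * ln (ln (real m ^ Suc k)))" for k
  define Z where "Z k x = (\<Sum>i\<in>{m ^ k..<m ^ Suc k}. X i x)" for k x
  define y where "y k = d * \<sigma> * lil_scale (m ^ Suc k)" for k
  have m_real: "1 < real m" using m(3) by simp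
  have n_real: "real (n k) = (real m - 1) * real m ^ k" for k
  proof -
    have "m ^ k \<le> m ^ Suc k" using m(3) by (intro power_increasing) auto
    then show ?thesis by (simp add: n_def of_nat_diff algebra_simps)
  qed
  have n_lim: "filterlim n at_top sequentially"
    unfolding filterlim_sequentially_iff_filterlim_real n_real using m_real by real_asymp
  have u_lim: "filterlim u at_top sequentially"
    unfolding u_def using m_real by real_asymp
  have un_lim: "(\<lambda>k. u k / sqrt (real (n k))) \<longlonglongrightarrow> 0"
    unfolding u_def n_real using m_real by real_asymp
  have power_lim: "filterlim (\<lambda>k. m ^ k) at_top sequentially"
  proof -
    have "filterlim (\<lambda>k. real m ^ k) at_top sequentially" using m_real by real_asymp
    then show ?thesis by (simp add: filterlim_sequentially_iff_filterlim_real)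
  qed
  have y_eq: "c * \<sigma> * sqrt (n k) * u k = y k" for k
  proof -
    have "sqrt (real m / (real m - 1)) * sqrt (n k) = sqrt (real m ^ Suc k)"
      unfolding n_real using m_real by (simp add: real_sqrt_mult[symmetric])
    then have "c * \<sigma> * sqrt (n k) * u k = d * \<sigma> * (sqrt (real m ^ Suc k) * u k)"
      by (simp add: c_def algebra_simps)
    also have "sqrt (real m ^ Suc k) * u k = lil_scale (m ^ Suc k)"
      unfolding u_def lil_scale_def by (simp add: real_sqrt_mult[symmetric] mult_ac)
    finally show ?thesis by (simp add: y_def)
  qed
  have prob_ge: "\<forall>\<^sub>F k in sequentially.
      (real (Suc k) * ln (real m)) powr - \<gamma> \<le> prob {x \<in> space M. y k \<le> Z k x}"
    using lower_tail[OF c(1) \<gamma>(1) n_lim u_lim un_lim]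
      eventually_compose_filterlim[OF eventually_ge_at_top[of 3] power_lim]
  proof eventually_elim
    case (elim k)
    have "m ^ k \<le> m ^ Suc k" using m(3) by (intro power_increasing) auto
    then have "3 \<le> real (m ^ Suc k)" using elim(2) by (simp del: of_nat_power power_Suc)
    then have "0 \<le> ln (ln (real m ^ Suc k))" by (intro ln_ln_nonneg) simp
    then have "(u k)\<^sup>2 / 2 = ln (ln (real m ^ Suc k))" by (simp add: u_def)
    also have "ln (real m ^ Suc k) = real (Suc k) * ln (real m)"
      using m_real by (subst ln_realpow) auto
    finally have "exp (- \<gamma> * (u k)\<^sup>2 / 2) = (real (Suc k) * ln (real m)) powr - \<gamma>"
      using m_real by (simp add: powr_def)
    moreover have "prob {x \<in> space M. y k \<le> Z k x} = prob {x \<in> space M. y k \<le> S (n k) x}"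
      unfolding Z_def by (subst prob_block_sum_ge) (simp_all add: n_def)
    ultimately show ?case using elim(1) unfolding y_eq by simp
  qed
  have "\<not> summable (\<lambda>k. prob {x \<in> space M. y k \<le> Z k x})"
  proof
    assume "summable (\<lambda>k. prob {x \<in> space M. y k \<le> Z k x})"
    then have "summable (\<lambda>k. (real (Suc k) * ln (real m)) powr - \<gamma>)"
      by (rule summable_comparison_test_ev[rotated]) (use prob_ge in simp)
    then have "summable (\<lambda>k. ln (real m) powr - \<gamma> * real (Suc k) powr - \<gamma>)"
      using m_real by (simp add: powr_mult mult.commute)
    then have "summable (\<lambda>k. real (Suc k) powr - \<gamma>)"
      by (rule summable_mult_D) (use m_real in simp)
    then have "summable (\<lambda>k. real k powr - \<gamma>)"
      by (subst (asm) summable_Suc_iff)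
    then show False using \<gamma> by (simp add: summable_real_powr_iff)
  qed
  moreover have "indep_vars (\<lambda>_. borel) Z UNIV"
    unfolding Z_def using m(3)
    by (intro indep_vars_block_sums[OF indep] disjoint_family_power_blocks) auto
  ultimately have Z_freq: "AE x in M. \<exists>\<^sub>F k in sequentially. y k \<le> Z k x"
    by (intro borel_cantelli2_AE)
  interpret neg: bounded_iid M "\<lambda>n x. - X n x" B \<sigma> by (rule uminus_bounded_iid)
  \<comment> \<open>Lower bound for the past. The factor 2 could be any constant above 1; it is the
    2 in the choice of \<open>m\<close>.\<close>
  have "AE x in M. \<forall>\<^sub>F n in sequentially. - S n x \<le> 2 * \<sigma> * lil_scale n"
    using neg.LIL_upper[of 2] by (simp add: sum_negf)
  with Z_freq show ?thesis
  proof eventually_elim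
    case (elim x)
    have "\<forall>\<^sub>F k in sequentially. y k \<le> Z k x \<longrightarrow>
        a * \<sigma> * lil_scale (m ^ Suc k) \<le> S (m ^ Suc k) x"
      using eventually_compose_filterlim[OF elim(2) power_lim]
        eventually_compose_filterlim[OF eventually_ge_at_top[of 3] power_lim]
    proof eventually_elim
      case (elim k)
      show ?case
      proof
        assume Z: "y k \<le> Z k x"
        have le: "m ^ k \<le> m ^ Suc k" using m(3) by (intro power_increasing) auto
        have "3 \<le> m ^ Suc k" using elim(2) le by (rule order_trans)
        then have nonneg: "0 \<le> lil_scale (m ^ Suc k)" by (rule lil_scale_nonneg)
        have "S (m ^ Suc k) x = S (m ^ k) x + Z k x"
          unfolding Z_def using le sum.atLeastLessThan_concat[of 0 "m ^ k" "m ^ Suc k" "\<lambda>i. X i x"]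
          by (simp add: atLeast0LessThan del: power_Suc)
        moreover have "2 * \<sigma> * lil_scale (m ^ k) \<le> 2 * \<sigma> * (lil_scale (m ^ Suc k) / sqrt m)"
          using sigma_pos lil_scale_power_le[OF m(3) elim(2)] by (intro mult_left_mono) auto
        moreover have "(2 / sqrt m) * (\<sigma> * lil_scale (m ^ Suc k)) \<le> (d - a) * (\<sigma> * lil_scale (m ^ Suc k))"
          using m(2) sigma_pos nonneg by (intro mult_right_mono) auto
        ultimately show "a * \<sigma> * lil_scale (m ^ Suc k) \<le> S (m ^ Suc k) x"
          using Z elim(1) unfolding y_def by (simp add: algebra_simps del: power_Suc)
      qed
    qed
    with elim(1) have "\<exists>\<^sub>F k in sequentially. a * \<sigma> * lil_scale (m ^ Suc k) \<le> S (m ^ Suc k) x"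
      by (rule frequently_mp[rotated])
    then show ?case
      by (rule frequently_compose_filterlim[where P="\<lambda>n. a * \<sigma> * lil_scale n \<le> S n x"])
         (rule filterlim_compose[OF power_lim filterlim_Suc])
  qed
qed

text \<open>Countably many factors approaching 1 from either side suffice, so one null set serves
  all of them.\<close>

lemma LIL_limsup: "AE x in M. limsup (\<lambda>n. ereal (S n x / lil_scale n)) = ereal \<sigma>"
proof -
  have "AE x in M. \<forall>j::nat. \<forall>\<^sub>F n in sequentially. S n x \<le> (1 + 1 / Suc j) * \<sigma> * lil_scale n"
    by (intro AE_all_countable[THEN iffD2] allI LIL_upper) simp
  \<comment> \<open>The double successor keeps the factor positive at \<open>j = 0\<close>, as
    \<open>LIL_lower\<close> demands.\<close>
  moreover have "AE x in M. \<forall>j::nat. \<exists>\<^sub>F n in sequentially. (1 - 1 / Suc (Suc j)) * \<sigma> * lil_scale n \<le> S n x"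
    by (intro AE_all_countable[THEN iffD2] allI LIL_lower) simp_all
  ultimately show ?thesis
  proof eventually_elim
    case (elim x)
    show ?case
    proof (rule limsup_ereal_eqI)
      fix b assume b: "\<sigma> < b"
      have "(\<lambda>j. (1 + 1 / real (Suc j)) * \<sigma>) \<longlonglongrightarrow> (1 + 0) * \<sigma>"
        by (intro tendsto_intros LIMSEQ_Suc[OF lim_1_over_n])
      then have "\<forall>\<^sub>F j in sequentially. (1 + 1 / real (Suc j)) * \<sigma> < b"
        using b by (intro order_tendstoD(2)) auto
      then obtain j :: nat where j: "(1 + 1 / real (Suc j)) * \<sigma> < b"
        by (auto simp: eventually_sequentially)
      show "\<forall>\<^sub>F n in sequentially. S n x / lil_scale n \<le> b"
        using elim(1)[rule_format, of j] lil_scale_pos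
      proof eventually_elim
        case (elim n)
        have "S n x / lil_scale n \<le> (1 + 1 / real (Suc j)) * \<sigma>"
          using elim by (simp add: pos_divide_le_eq del: of_nat_Suc)
        then show ?case using j by simp
      qed
    next
      fix b assume b: "b < \<sigma>"
      have "(\<lambda>j. (1 - 1 / real (Suc (Suc j))) * \<sigma>) \<longlonglongrightarrow> (1 - 0) * \<sigma>"
        by (intro tendsto_intros LIMSEQ_Suc[OF LIMSEQ_Suc[OF lim_1_over_n]])
      then have "\<forall>\<^sub>F j in sequentially. b < (1 - 1 / real (Suc (Suc j))) * \<sigma>"
        using b by (intro order_tendstoD(1)) auto
      then obtain j :: nat where j: "b < (1 - 1 / real (Suc (Suc j))) * \<sigma>"
        by (auto simp: eventually_sequentially)
      have "\<forall>\<^sub>F n in sequentially. (1 - 1 / Suc (Suc j)) * \<sigma> * lil_scale n \<le> S n x \<longrightarrow> b \<le> S n x / lil_scale n"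
        using lil_scale_pos
      proof eventually_elim
        case (elim n)
        show ?case
        proof
          assume "(1 - 1 / Suc (Suc j)) * \<sigma> * lil_scale n \<le> S n x"
          then have "(1 - 1 / real (Suc (Suc j))) * \<sigma> \<le> S n x / lil_scale n"
            using elim by (simp add: pos_le_divide_eq del: of_nat_Suc)
          then show "b \<le> S n x / lil_scale n" using j by simp
        qed
      qed
      then show "\<exists>\<^sub>F n in sequentially. b \<le> S n x / lil_scale n"
        using elim(2)[rule_format, of j] by (rule frequently_mp)
    qed
  qed
qed

theorem law_of_iterated_logarithm:
  "AE x in M. limsup (\<lambda>n. ereal (S n x / lil_scale n)) = ereal \<sigma> \<and>
    liminf (\<lambda>n. ereal (S n x / lil_scale n)) = ereal (- \<sigma>)"
proof -
  interpret neg: bounded_iid M "\<lambda>n x. - X n x" B \<sigma> by (rule uminus_bounded_iid)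
  show ?thesis
    using LIL_limsup neg.LIL_limsup
  proof eventually_elim
    case (elim x)
    have "limsup (\<lambda>n. - ereal (S n x / lil_scale n)) = ereal \<sigma>"
      using elim(2) by (simp add: sum_negf)
    then have "- liminf (\<lambda>n. ereal (S n x / lil_scale n)) = ereal \<sigma>"
      unfolding ereal_Limsup_uminus .
    then have "liminf (\<lambda>n. ereal (S n x / lil_scale n)) = ereal (- \<sigma>)"
      by (metis ereal_uminus_uminus uminus_ereal.simps(1))
    with elim(1) show ?case by simp
  qed
qed

end

section \<open>The walk that remembers its first two steps\<close>

text \<open>Monotonicity replaces uniform convergence: a fixed point slightly to one side of
  \<open>z\<close> eventually lies on that side of \<open>w n\<close>, and continuity makes the
  limit there close to \<open>G z\<close>.\<close>

lemma tendsto_mono_at_moving_point: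
  fixes F :: "nat \<Rightarrow> real \<Rightarrow> real" and G :: "real \<Rightarrow> real"
  assumes mono: "\<And>n s t. s \<le> t \<Longrightarrow> F n s \<le> F n t"
    and lim: "\<And>s. (\<lambda>n. F n s) \<longlonglongrightarrow> G s"
    and cont: "isCont G z" and z: "w \<longlonglongrightarrow> z"
  shows "(\<lambda>n. F n (w n)) \<longlonglongrightarrow> G z"
proof (rule order_tendstoI)
  fix a assume "a < G z"
  then have "\<forall>\<^sub>F s in at z. a < G s" using cont by (intro order_tendstoD) (auto simp: isCont_def)
  then have "\<forall>\<^sub>F s in at_left z. a < G s \<and> s < z"
    unfolding eventually_at_split by (intro eventually_conj) (simp_all add: eventually_at_filter)
  then obtain s where s: "a < G s" "s < z"
    using eventually_happens'[OF trivial_limit_at_left_real[of z]] by auto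
  show "\<forall>\<^sub>F n in sequentially. a < F n (w n)"
    using order_tendstoD(1)[OF lim s(1)] order_tendstoD(1)[OF z s(2)]
    by eventually_elim (use mono in \<open>meson less_imp_le less_le_trans\<close>)
next
  fix a assume "G z < a"
  then have "\<forall>\<^sub>F s in at z. G s < a" using cont by (intro order_tendstoD) (auto simp: isCont_def)
  then have "\<forall>\<^sub>F s in at_right z. G s < a \<and> z < s"
    unfolding eventually_at_split by (intro eventually_conj) (simp_all add: eventually_at_filter)
  then obtain s where s: "G s < a" "z < s"
    using eventually_happens'[OF trivial_limit_at_right_real[of z]] by auto
  show "\<forall>\<^sub>F n in sequentially. F n (w n) < a"
    using order_tendstoD(2)[OF lim s(1)] order_tendstoD(2)[OF z s(2)]
    by eventually_elim (use mono in \<open>meson less_imp_le le_less_trans\<close>)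
qed

text \<open>The first two steps add the constant \<open>c\<close> and shift the time by 2. Solved
  for \<open>S n x\<close>, the event has a threshold \<open>w n\<close> that moves with
  \<open>n\<close> and tends to \<open>y / \<sigma>\<close>.\<close>

lemma (in bounded_iid) clt_cdf_shifted:
  "(\<lambda>n. prob {x \<in> space M. (c + S n x) / sqrt (real (n + 2)) \<le> y}) \<longlonglongrightarrow> cdf std_normal_distribution (y / \<sigma>)"
proof -
  define w where "w n = (y * sqrt (real (n + 2)) - c) / (\<sigma> * sqrt (real n))" for n :: nat
  have "w \<longlonglongrightarrow> y / \<sigma>"
  proof -
    have "(\<lambda>n. (1 / \<sigma>) * ((y * sqrt (real (n + 2)) - c) / sqrt (real n))) \<longlonglongrightarrow> (1 / \<sigma>) * y"
      by (intro tendsto_intros) real_asymp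
    then show ?thesis unfolding w_def by (simp add: field_simps)
  qed
  then have "(\<lambda>n. prob {x \<in> space M. S n x \<le> w n * (\<sigma> * sqrt n)}) \<longlonglongrightarrow> cdf std_normal_distribution (y / \<sigma>)"
  proof (rule tendsto_mono_at_moving_point[OF _ clt_cdf isCont_cdf_std_normal, rotated])
    fix n :: nat and s t :: real assume "s \<le> t"
    then have "s * (\<sigma> * sqrt n) \<le> t * (\<sigma> * sqrt n)"
      using sigma_pos by (intro mult_right_mono) auto
    then show "prob {x \<in> space M. S n x \<le> s * (\<sigma> * sqrt n)} \<le> prob {x \<in> space M. S n x \<le> t * (\<sigma> * sqrt n)}"
      by (intro finite_measure_mono) auto
  qed
  moreover have "\<forall>\<^sub>F n in sequentially. prob {x \<in> space M. S n x \<le> w n * (\<sigma> * sqrt n)} =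
      prob {x \<in> space M. (c + S n x) / sqrt (real (n + 2)) \<le> y}"
    using eventually_gt_at_top[of 0]
  proof eventually_elim
    case (elim n)
    have "w n * (\<sigma> * sqrt n) = y * sqrt (real (n + 2)) - c"
      using elim sigma_pos by (simp add: w_def)
    then have "S n x \<le> w n * (\<sigma> * sqrt n) \<longleftrightarrow> (c + S n x) / sqrt (real (n + 2)) \<le> y" for x
      by (simp add: pos_divide_le_eq) linarith
    then show ?case by simp
  qed
  ultimately show ?thesis by (rule Lim_transform_eventually)
qed

text \<open>Finite limsup and liminf make the normalised sums \<open>f\<close> bounded, and the
  ratio \<open>\<rho>\<close> of scales tends to 1. Hence the two normalised sequences differ by the
  null sequence \<open>e\<close>. Boundedness of \<open>f\<close> also gives the law of large
  numbers, as the scale is small against \<open>n\<close>.\<close>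

lemma lil_shift:
  fixes s D :: "nat \<Rightarrow> real"
  assumes D: "\<And>n. D (n + 2) = c + s n"
    and limsup: "limsup (\<lambda>n. ereal (s n / lil_scale n)) = ereal \<sigma>"
    and liminf: "liminf (\<lambda>n. ereal (s n / lil_scale n)) = ereal (- \<sigma>)"
  shows "limsup (\<lambda>n. ereal (D n / lil_scale n)) = ereal \<sigma>"
    and "liminf (\<lambda>n. ereal (D n / lil_scale n)) = ereal (- \<sigma>)"
    and "(\<lambda>n. D n / real n) \<longlonglongrightarrow> 0"
proof -
  define f where "f n = s n / lil_scale n" for n
  define \<rho> where "\<rho> n = lil_scale n / lil_scale (n + 2)" for n
  define e where "e n = c / lil_scale (n + 2) + f n * (\<rho> n - 1)" for n
  have "\<forall>\<^sub>F n in sequentially. ereal (f n) < ereal (\<sigma> + 1)"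
    by (rule Limsup_lessD) (simp add: f_def limsup)
  moreover have "\<forall>\<^sub>F n in sequentially. ereal (- \<sigma> - 1) < ereal (f n)"
    by (rule less_LiminfD) (simp add: f_def liminf)
  ultimately have f_bound: "\<forall>\<^sub>F n in sequentially. \<bar>f n\<bar> \<le> \<bar>\<sigma>\<bar> + 1"
    by eventually_elim auto
  have f_null: "(\<lambda>n. f n * h n) \<longlonglongrightarrow> 0" if h: "h \<longlonglongrightarrow> 0" for h
  proof (rule tendsto_rabs_zero_cancel, rule tendsto_sandwich[where f="\<lambda>_. 0"])
    show "\<forall>\<^sub>F n in sequentially. \<bar>f n * h n\<bar> \<le> (\<bar>\<sigma>\<bar> + 1) * \<bar>h n\<bar>"
      using f_bound by eventually_elim (simp add: abs_mult mult_right_mono)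
    show "(\<lambda>n. (\<bar>\<sigma>\<bar> + 1) * \<bar>h n\<bar>) \<longlonglongrightarrow> 0"
      using tendsto_mult[OF tendsto_const tendsto_rabs[OF h], of "\<bar>\<sigma>\<bar> + 1"] by simp
  qed auto
  have scale2: "filterlim (\<lambda>n. lil_scale (n + 2)) at_top sequentially"
    unfolding lil_scale_def by real_asymp
  have "(\<lambda>n. \<rho> n - 1) \<longlonglongrightarrow> 0"
    unfolding \<rho>_def lil_scale_def by real_asymp
  then have "e \<longlonglongrightarrow> 0 + 0"
    unfolding e_def by (intro tendsto_add f_null tendsto_divide_0[OF tendsto_const]
        filterlim_at_top_imp_at_infinity scale2)
  then have e: "e \<longlonglongrightarrow> 0" by simp
  then have e': "(\<lambda>n. ereal (e n)) \<longlonglongrightarrow> 0" by (simp add: zero_ereal_def)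
  have eq: "\<forall>\<^sub>F n in sequentially. D (n + 2) / lil_scale (n + 2) = e n + f n"
    using lil_scale_pos eventually_compose_filterlim[OF eventually_gt_at_top[of 0] scale2]
    unfolding D e_def f_def \<rho>_def by eventually_elim (simp add: field_simps)
  then have eq': "\<forall>\<^sub>F n in sequentially. ereal (D (n + 2) / lil_scale (n + 2)) = ereal (e n) + ereal (f n)"
    by eventually_elim simp
  have "limsup (\<lambda>n. ereal (D (n + 2) / lil_scale (n + 2))) = limsup (\<lambda>n. ereal (e n) + ereal (f n))"
    by (rule Limsup_eq[OF eq'])
  also have "\<dots> = ereal \<sigma>"
    using ereal_limsup_lim_add[OF e', of "\<lambda>n. ereal (f n)"] limsup by (simp add: f_def)
  finally show "limsup (\<lambda>n. ereal (D n / lil_scale n)) = ereal \<sigma>"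
    using limsup_shift_k[of "\<lambda>n. ereal (D n / lil_scale n)" 2] by simp
  have "liminf (\<lambda>n. ereal (D (n + 2) / lil_scale (n + 2))) = liminf (\<lambda>n. ereal (e n) + ereal (f n))"
    by (rule Liminf_eq[OF eq'])
  also have "\<dots> = ereal (- \<sigma>)"
    using ereal_liminf_lim_add[OF e', of "\<lambda>n. ereal (f n)"] liminf by (simp add: f_def)
  finally show "liminf (\<lambda>n. ereal (D n / lil_scale n)) = ereal (- \<sigma>)"
    using liminf_shift_k[of "\<lambda>n. ereal (D n / lil_scale n)" 2] by simp
  have "(\<lambda>n. c * (1 / real (n + 2)) + f n * (lil_scale n / real (n + 2))) \<longlonglongrightarrow> c * 0 + 0"
    unfolding lil_scale_def by (intro tendsto_add tendsto_mult tendsto_const f_null) real_asymp+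
  moreover have "\<forall>\<^sub>F n in sequentially.
      c * (1 / real (n + 2)) + f n * (lil_scale n / real (n + 2)) = D (n + 2) / real (n + 2)"
    unfolding D f_def using lil_scale_pos by eventually_elim (simp add: add_divide_distrib)
  ultimately have "(\<lambda>n. D (n + 2) / real (n + 2)) \<longlonglongrightarrow> 0"
    by (simp add: tendsto_cong)
  then show "(\<lambda>n. D n / real n) \<longlonglongrightarrow> 0"
    by (rule LIMSEQ_offset[where k=2])
qed

section \<open>The walk and the law of a single step with prescribed first steps\<close>

locale two_step_erw = prob_space +
  fixes p q r :: real and X1 :: "'a \<Rightarrow> real" and eta :: "nat \<Rightarrow> 'a \<Rightarrow> real" and K :: "nat \<Rightarrow> 'a \<Rightarrow> nat"
  assumes p: "0 < p" and q: "0 < q" and r: "0 < r" and pqr: "p + q + r = 1"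
    and indep: "indep_vars (\<lambda>_. borel) (erw_family X1 eta K) erw_index"
    and X1_rv [measurable]: "random_variable borel X1"
    and eta_rv: "\<And>n. n \<ge> 2 \<Longrightarrow> random_variable borel (eta n)"
    and K_rv: "\<And>n. n \<ge> 3 \<Longrightarrow> random_variable (count_space UNIV) (K n)"
    and X1_prob: "prob {\<omega> \<in> space M. X1 \<omega> = 1} = p" "prob {\<omega> \<in> space M. X1 \<omega> = -1} = q"
      "prob {\<omega> \<in> space M. X1 \<omega> = 0} = r"
    and eta_prob: "\<And>n. n \<ge> 2 \<Longrightarrow> prob {\<omega> \<in> space M. eta n \<omega> = 1} = p"
      "\<And>n. n \<ge> 2 \<Longrightarrow> prob {\<omega> \<in> space M. eta n \<omega> = -1} = q"
      "\<And>n. n \<ge> 2 \<Longrightarrow> prob {\<omega> \<in> space M. eta n \<omega> = 0} = r"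
    and K_prob: "\<And>n. n \<ge> 3 \<Longrightarrow> prob {\<omega> \<in> space M. K n \<omega> = 1} = 1/2"
      "\<And>n. n \<ge> 3 \<Longrightarrow> prob {\<omega> \<in> space M. K n \<omega> = 2} = 1/2"
begin

text \<open>The common point masses of \<open>X1\<close> and of each \<open>eta n\<close>; the final
  branch is only ever evaluated at 0.\<close>

definition weight :: "real \<Rightarrow> real" where
  "weight e = (if e = 1 then p else if e = -1 then q else r)"

lemma AE_signs:
  assumes [measurable]: "random_variable borel Z"
    and "prob {\<omega> \<in> space M. Z \<omega> = 1} = p" "prob {\<omega> \<in> space M. Z \<omega> = -1} = q"
      "prob {\<omega> \<in> space M. Z \<omega> = (0::real)} = r"
  shows "AE \<omega> in M. Z \<omega> \<in> {1, -1, 0}"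
proof -
  have "prob {\<omega> \<in> space M. Z \<omega> \<in> {1, -1, 0}} = prob (\<Union>e\<in>{1, -1, 0}. {\<omega> \<in> space M. Z \<omega> = e})"
    by (rule arg_cong[where f=prob]) auto
  also have "\<dots> = (\<Sum>e\<in>{1, -1, 0}. prob {\<omega> \<in> space M. Z \<omega> = e})"
    by (rule finite_measure_finite_Union) (auto simp: disjoint_family_on_def)
  also have "\<dots> = 1" using assms pqr by simp
  finally show ?thesis by (subst (asm) prob_Collect_eq_1) auto
qed

lemma AE_X1: "AE \<omega> in M. X1 \<omega> \<in> {1, -1, 0}"
  using AE_signs X1_prob X1_rv by blast

lemma AE_eta: "n \<ge> 2 \<Longrightarrow> AE \<omega> in M. eta n \<omega> \<in> {1, -1, 0}"
  using AE_signs eta_prob eta_rv by blast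

lemma AE_K:
  assumes n: "n \<ge> 3"
  shows "AE \<omega> in M. K n \<omega> \<in> {1, 2}"
proof -
  note [measurable] = K_rv[OF n]
  have "prob {\<omega> \<in> space M. K n \<omega> \<in> {1, 2}} = prob (\<Union>b\<in>{1, 2}. {\<omega> \<in> space M. K n \<omega> = b})"
    by (rule arg_cong[where f=prob]) auto
  also have "\<dots> = (\<Sum>b\<in>{1, 2}. prob {\<omega> \<in> space M. K n \<omega> = b})"
    by (rule finite_measure_finite_Union) (auto simp: disjoint_family_on_def)
  also have "\<dots> = 1" using K_prob(1)[OF n] K_prob(2)[OF n] by simp
  finally show ?thesis by (subst (asm) prob_Collect_eq_1) auto
qed

lemma prob_pair:
  assumes "i \<in> erw_index" "j \<in> erw_index" "i \<noteq> j"
  shows "prob {\<omega> \<in> space M. erw_family X1 eta K i \<omega> = a \<and> erw_family X1 eta K j \<omega> = b} =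
    prob {\<omega> \<in> space M. erw_family X1 eta K i \<omega> = a} * prob {\<omega> \<in> space M. erw_family X1 eta K j \<omega> = b}"
proof -
  let ?F = "erw_family X1 eta K"
  have "prob (\<Inter>k\<in>{i, j}. ?F k -` {if k = i then a else b} \<inter> space M) =
      (\<Prod>k\<in>{i, j}. prob (?F k -` {if k = i then a else b} \<inter> space M))"
    using assms by (intro indep_varsD[OF indep]) auto
  also have "(\<Inter>k\<in>{i, j}. ?F k -` {if k = i then a else b} \<inter> space M) =
      {\<omega> \<in> space M. ?F i \<omega> = a \<and> ?F j \<omega> = b}"
    using assms by auto
  also have "(\<Prod>k\<in>{i, j}. prob (?F k -` {if k = i then a else b} \<inter> space M)) =
      prob (?F i -` {a} \<inter> space M) * prob (?F j -` {b} \<inter> space M)"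
    using assms by simp
  also have "?F i -` {a} \<inter> space M = {\<omega> \<in> space M. ?F i \<omega> = a}" by auto
  also have "?F j -` {b} \<inter> space M = {\<omega> \<in> space M. ?F j \<omega> = b}" by auto
  finally show ?thesis .
qed

lemma prob_eta_K:
  assumes "n \<ge> 3" "e \<in> {1, -1, 0}" "b \<in> {1, 2}"
  shows "prob {\<omega> \<in> space M. eta n \<omega> = e \<and> K n \<omega> = b} = weight e / 2"
proof -
  have "prob {\<omega> \<in> space M. eta n \<omega> = e \<and> K n \<omega> = b} =
      prob {\<omega> \<in> space M. eta n \<omega> = e} * prob {\<omega> \<in> space M. K n \<omega> = b}"
    using prob_pair[of "IEta n" "IK n" e "real b"] assms(1)
    by (simp add: erw_index_def erw_family_def)
  then show ?thesis using assms eta_prob K_prob by (auto simp: weight_def)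
qed

lemma prob_X1_eta2:
  assumes "a \<in> {1, -1, 0}" "e \<in> {1, -1, 0}"
  shows "prob {\<omega> \<in> space M. X1 \<omega> = a \<and> eta 2 \<omega> = e} = weight a * weight e"
proof -
  have "prob {\<omega> \<in> space M. X1 \<omega> = a \<and> eta 2 \<omega> = e} =
      prob {\<omega> \<in> space M. X1 \<omega> = a} * prob {\<omega> \<in> space M. eta 2 \<omega> = e}"
    using prob_pair[of "IX1" "IEta 2" a e] by (simp add: erw_index_def erw_family_def)
  then show ?thesis using assms eta_prob X1_prob by (auto simp: weight_def)
qed

text \<open>The step X_{k+3} of the walk whose first two steps are x1 and x2.\<close>

definition Y :: "real \<Rightarrow> real \<Rightarrow> nat \<Rightarrow> 'a \<Rightarrow> real" where
  "Y x1 x2 k \<omega> = eta (k + 3) \<omega> * (if K (k + 3) \<omega> = 1 then x1 else x2)"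

lemma Y_rv [measurable]: "random_variable borel (Y x1 x2 k)"
proof -
  have [measurable]: "random_variable borel (eta (k + 3))" "random_variable (count_space UNIV) (K (k + 3))"
    by (auto intro: eta_rv K_rv)
  show ?thesis unfolding Y_def[abs_def] by measurable
qed

text \<open>Splitting over the six outcomes of sign and memory gives an expression free of
  \<open>k\<close>. Indicators for \<open>f\<close> then yield equality of distributions, and the
  centred identity and its square yield the moments.\<close>

lemma expectation_Y:
  fixes f :: "real \<Rightarrow> real"
  assumes [measurable]: "f \<in> borel_measurable borel"
  shows "expectation (\<lambda>\<omega>. f (Y x1 x2 k \<omega>)) =
    (p * f x1 + q * f (- x1) + r * f 0 + p * f x2 + q * f (- x2) + r * f 0) / 2"
proof -
  define E where "E e b = {\<omega> \<in> space M. eta (k + 3) \<omega> = e \<and> K (k + 3) \<omega> = b}" for e b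
  define v where "v e b = f (e * (if b = (1::nat) then x1 else x2))" for e b
  have [measurable]: "random_variable borel (eta (k + 3))" "random_variable (count_space UNIV) (K (k + 3))"
    by (auto intro: eta_rv K_rv)
  have E_meas [measurable]: "E e b \<in> events" for e b unfolding E_def by measurable
  have "expectation (\<lambda>\<omega>. f (Y x1 x2 k \<omega>)) =
      expectation (\<lambda>\<omega>. \<Sum>e\<in>{1, -1, 0}. \<Sum>b\<in>{1, 2}. v e b * indicator (E e b) \<omega>)"
  proof (rule integral_cong_AE)
    have "AE \<omega> in M. eta (k + 3) \<omega> \<in> {1, -1, 0}" "AE \<omega> in M. K (k + 3) \<omega> \<in> {1, 2}"
      by (rule AE_eta AE_K, simp)+
    then show "AE \<omega> in M. f (Y x1 x2 k \<omega>) = (\<Sum>e\<in>{1, -1, 0}. \<Sum>b\<in>{1, 2}. v e b * indicator (E e b) \<omega>)"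
      using AE_space by eventually_elim (auto simp: Y_def v_def E_def indicator_def)
  qed measurable
  also have "\<dots> = (\<Sum>e\<in>{1, -1, 0}. \<Sum>b\<in>{1, 2}. expectation (\<lambda>\<omega>. v e b * indicator (E e b) \<omega>))"
  proof -
    have int: "integrable M (\<lambda>\<omega>. v e b * indicator (E e b) \<omega>)" for e b
      by (intro integrable_mult_right) (simp add: emeasure_eq_measure)
    show ?thesis
      by (simp only: Bochner_Integration.integral_sum Bochner_Integration.integrable_sum int)
  qed
  also have "\<dots> = (\<Sum>e\<in>{1, -1, 0}. \<Sum>b\<in>{1, 2}. v e b * prob (E e b))"
    by (intro sum.cong refl) simp
  also have "\<dots> = (\<Sum>e\<in>{1, -1, 0}. \<Sum>b\<in>{1, 2}. v e b * (weight e / 2))"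
    unfolding E_def using prob_eta_K[of "k + 3"] by (intro sum.cong refl) simp
  also have "\<dots> = (p * f x1 + q * f (- x1) + r * f 0 + p * f x2 + q * f (- x2) + r * f 0) / 2"
    by (simp add: v_def weight_def field_simps)
  finally show ?thesis .
qed

text \<open>Since \<open>r > 0\<close>,
  \<open>(p - q)\<^sup>2 \<le> (p + q)\<^sup>2 < p + q\<close>; and the square of a mean of two
  numbers is at most the mean of their squares.\<close>

lemma erw_variance_pos:
  assumes "x1\<^sup>2 + x2\<^sup>2 \<noteq> 0"
  shows "(erw_mu p q x1 x2)\<^sup>2 < (p + q) * (x1\<^sup>2 + x2\<^sup>2) / 2"
proof -
  have pos: "0 < x1\<^sup>2 + x2\<^sup>2" using assms by (metis add_nonneg_nonneg less_le zero_le_power2)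
  have "(p - q)\<^sup>2 < p + q"
  proof -
    have "(p - q)\<^sup>2 \<le> (p + q)\<^sup>2" using p q by (intro power2_le_iff_abs_le[THEN iffD2]) auto
    also have "\<dots> < (p + q) * 1"
      unfolding power2_eq_square using p q r pqr by (intro mult_strict_left_mono) auto
    finally show ?thesis by simp
  qed
  then have "(p - q)\<^sup>2 * ((x1\<^sup>2 + x2\<^sup>2) / 2) < (p + q) * ((x1\<^sup>2 + x2\<^sup>2) / 2)"
    using pos by (intro mult_strict_right_mono) auto
  moreover have "(x1 + x2)\<^sup>2 / 4 \<le> (x1\<^sup>2 + x2\<^sup>2) / 2"
    using zero_le_power2[of "x1 - x2"] by (simp add: power2_eq_square algebra_simps)
  then have "(p - q)\<^sup>2 * ((x1 + x2)\<^sup>2 / 4) \<le> (p - q)\<^sup>2 * ((x1\<^sup>2 + x2\<^sup>2) / 2)"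
    by (rule mult_left_mono) simp
  ultimately show ?thesis
    by (simp add: erw_mu_def power_divide power_mult_distrib)
qed

text \<open>Independence holds because step \<open>k\<close> reads only the two coordinates in
  \<open>J k\<close>, and these pairs are disjoint for different \<open>k\<close>.\<close>

lemma centred_Y_iid:
  assumes nz: "x1\<^sup>2 + x2\<^sup>2 \<noteq> 0"
  shows "bounded_iid M (\<lambda>k \<omega>. Y x1 x2 k \<omega> - erw_mu p q x1 x2)
    (\<bar>x1\<bar> + \<bar>x2\<bar> + \<bar>erw_mu p q x1 x2\<bar>) (erw_sigma p q x1 x2)"
proof
  let ?mu = "erw_mu p q x1 x2"
  show "indep_vars (\<lambda>_. borel) (\<lambda>k \<omega>. Y x1 x2 k \<omega> - ?mu) UNIV"
  proof -
    define J where "J k = {IEta (k + 3), IK (k + 3)}" for k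
    define g where "g k x = x (IEta (k + 3)) * (if x (IK (k + 3)) = 1 then x1 else x2) - ?mu"
      for k and x :: "erw_idx \<Rightarrow> real"
    have "indep_vars (\<lambda>k. PiM (J k) (\<lambda>_. borel)) (\<lambda>k \<omega>. restrict (\<lambda>i. erw_family X1 eta K i \<omega>) (J k)) UNIV"
      by (rule indep_vars_restrict[OF indep]) (auto simp: J_def erw_index_def disjoint_family_on_def)
    then have "indep_vars (\<lambda>_. borel) (\<lambda>k \<omega>. g k (restrict (\<lambda>i. erw_family X1 eta K i \<omega>) (J k))) UNIV"
    proof (rule indep_vars_compose2)
      fix k
      have [measurable]: "(\<lambda>x. x i) \<in> borel_measurable (PiM (J k) (\<lambda>_. borel :: real measure))" if "i \<in> J k" for i
        using that by (rule measurable_component_singleton)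
      have [simp]: "IEta (k + 3) \<in> J k" "IK (k + 3) \<in> J k" by (auto simp: J_def)
      show "g k \<in> borel_measurable (PiM (J k) (\<lambda>_. borel))"
        unfolding g_def[abs_def] by measurable
    qed
    moreover have "g k (restrict (\<lambda>i. erw_family X1 eta K i \<omega>) (J k)) = Y x1 x2 k \<omega> - ?mu" for k \<omega>
      by (simp add: g_def J_def Y_def erw_family_def)
    ultimately show ?thesis by simp
  qed
  show "distr M borel (\<lambda>\<omega>. Y x1 x2 n \<omega> - ?mu) = distr M borel (\<lambda>\<omega>. Y x1 x2 0 \<omega> - ?mu)" for n
  proof (rule measure_eqI)
    fix A assume "A \<in> sets (distr M borel (\<lambda>\<omega>. Y x1 x2 n \<omega> - ?mu))"
    then have [measurable]: "A \<in> sets borel" by simp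
    have "emeasure (distr M borel (\<lambda>\<omega>. Y x1 x2 k \<omega> - ?mu)) A =
        ennreal (expectation (\<lambda>\<omega>. indicator A (Y x1 x2 k \<omega> - ?mu)))" for k
    proof -
      have "emeasure (distr M borel (\<lambda>\<omega>. Y x1 x2 k \<omega> - ?mu)) A =
          ennreal (prob ((\<lambda>\<omega>. Y x1 x2 k \<omega> - ?mu) -` A \<inter> space M))"
        by (simp add: emeasure_distr emeasure_eq_measure)
      also have "prob ((\<lambda>\<omega>. Y x1 x2 k \<omega> - ?mu) -` A \<inter> space M) =
          expectation (indicator ((\<lambda>\<omega>. Y x1 x2 k \<omega> - ?mu) -` A \<inter> space M))"
        by simp
      also have "\<dots> = expectation (\<lambda>\<omega>. indicator A (Y x1 x2 k \<omega> - ?mu))"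
        by (rule Bochner_Integration.integral_cong) (auto simp: indicator_def)
      finally show ?thesis .
    qed
    then show "emeasure (distr M borel (\<lambda>\<omega>. Y x1 x2 n \<omega> - ?mu)) A =
        emeasure (distr M borel (\<lambda>\<omega>. Y x1 x2 0 \<omega> - ?mu)) A"
      using expectation_Y[of "\<lambda>x. indicator A (x - ?mu)" x1 x2] by simp
  qed simp
  show "AE \<omega> in M. \<bar>Y x1 x2 n \<omega> - ?mu\<bar> \<le> \<bar>x1\<bar> + \<bar>x2\<bar> + \<bar>?mu\<bar>" for n
  proof -
    have "AE \<omega> in M. eta (n + 3) \<omega> \<in> {1, -1, 0}" by (rule AE_eta) simp
    then show ?thesis by eventually_elim (auto simp: Y_def)
  qed
  show "expectation (\<lambda>\<omega>. Y x1 x2 n \<omega> - ?mu) = 0" for n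
  proof -
    have r_eq: "r = 1 - p - q" using pqr by simp
    show ?thesis
      by (subst expectation_Y[of "\<lambda>x. x - ?mu"]) (simp_all add: r_eq erw_mu_def field_simps)
  qed
  show "expectation (\<lambda>\<omega>. (Y x1 x2 n \<omega> - ?mu)\<^sup>2) = (erw_sigma p q x1 x2)\<^sup>2" for n
  proof -
    have r_eq: "r = 1 - p - q" using pqr by simp
    have "expectation (\<lambda>\<omega>. (Y x1 x2 n \<omega> - ?mu)\<^sup>2) = (p + q) * (x1\<^sup>2 + x2\<^sup>2) / 2 - ?mu\<^sup>2"
      by (subst expectation_Y[of "\<lambda>x. (x - ?mu)\<^sup>2"])
         (simp_all add: r_eq erw_mu_def field_simps power2_eq_square)
    then show ?thesis
      using erw_variance_pos[OF nz] by (simp add: erw_sigma_def)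
  qed
  show "0 < erw_sigma p q x1 x2"
    using erw_variance_pos[OF nz] by (simp add: erw_sigma_def)
qed

section \<open>Decomposition of the centred walk and its almost sure behaviour\<close>

lemma erw_S_eq:
  defines "x1 \<equiv> \<lambda>\<omega>. X1 \<omega>" and "x2 \<equiv> \<lambda>\<omega>. eta 2 \<omega> * X1 \<omega>"
  shows "erw_S X1 eta K (n + 2) \<omega> = x1 \<omega> + x2 \<omega> + (\<Sum>k<n. Y (x1 \<omega>) (x2 \<omega>) k \<omega>)"
proof (induction n)
  case 0
  show ?case by (simp add: erw_S_def x1_def x2_def numeral_2_eq_2)
next
  case (Suc n)
  have "erw_S X1 eta K (Suc n + 2) \<omega> = erw_S X1 eta K (n + 2) \<omega> + erw_X X1 eta K (Suc (Suc (Suc n))) \<omega>"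
    by (simp add: erw_S_def)
  also have "erw_X X1 eta K (Suc (Suc (Suc n))) \<omega> = Y (x1 \<omega>) (x2 \<omega>) n \<omega>"
    by (simp add: Y_def x1_def x2_def)
  finally show ?case using Suc.IH by simp
qed

abbreviation X2 :: "'a \<Rightarrow> real" where
  "X2 \<omega> \<equiv> eta 2 \<omega> * X1 \<omega>"

abbreviation D :: "nat \<Rightarrow> 'a \<Rightarrow> real" where
  "D n \<omega> \<equiv> erw_S X1 eta K n \<omega> - real n * (p - q) * (X1 \<omega> + X2 \<omega>) / 2"

abbreviation centred_sum :: "real \<Rightarrow> real \<Rightarrow> nat \<Rightarrow> 'a \<Rightarrow> real" where
  "centred_sum x1 x2 n \<omega> \<equiv> \<Sum>k<n. Y x1 x2 k \<omega> - erw_mu p q x1 x2"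

text \<open>What the first two steps leave after centring: all \<open>n + 2\<close> steps are
  centred by \<open>erw_mu\<close>, but only the last \<open>n\<close> of them enter
  \<open>centred_sum\<close>.\<close>

abbreviation offset :: "real \<Rightarrow> real \<Rightarrow> real" where
  "offset x1 x2 \<equiv> x1 + x2 - 2 * erw_mu p q x1 x2"

lemma D_eq: "D (n + 2) \<omega> = offset (X1 \<omega>) (X2 \<omega>) + centred_sum (X1 \<omega>) (X2 \<omega>) n \<omega>"
  unfolding erw_S_eq sum_subtractf by (simp add: erw_mu_def field_simps)

lemma eta2_rv [measurable]: "random_variable borel (eta 2)"
  by (rule eta_rv) simp

text \<open>The law is applied to constants \<open>x1\<close> and \<open>x2\<close>; a finite union
  of null sets covers all their possible values, after which the random values may be substituted
  pointwise.\<close>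

lemma AE_lil:
  "AE \<omega> in M. (X1 \<omega>)\<^sup>2 + (X2 \<omega>)\<^sup>2 \<noteq> 0 \<longrightarrow>
     limsup (\<lambda>n. ereal (D n \<omega> / lil_scale n)) = ereal (erw_sigma p q (X1 \<omega>) (X2 \<omega>)) \<and>
     liminf (\<lambda>n. ereal (D n \<omega> / lil_scale n)) = ereal (- erw_sigma p q (X1 \<omega>) (X2 \<omega>)) \<and>
     (\<lambda>n. D n \<omega> / real n) \<longlonglongrightarrow> 0"
proof -
  have lil: "AE \<omega> in M. x1\<^sup>2 + x2\<^sup>2 \<noteq> 0 \<longrightarrow>
      limsup (\<lambda>n. ereal (centred_sum x1 x2 n \<omega> / lil_scale n)) = ereal (erw_sigma p q x1 x2) \<and>
      liminf (\<lambda>n. ereal (centred_sum x1 x2 n \<omega> / lil_scale n)) = ereal (- erw_sigma p q x1 x2)" for x1 x2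
  proof (cases "x1\<^sup>2 + x2\<^sup>2 = 0")
    case False
    then interpret iid: bounded_iid M "\<lambda>k \<omega>. Y x1 x2 k \<omega> - erw_mu p q x1 x2"
      "\<bar>x1\<bar> + \<bar>x2\<bar> + \<bar>erw_mu p q x1 x2\<bar>" "erw_sigma p q x1 x2"
      by (rule centred_Y_iid)
    show ?thesis using iid.law_of_iterated_logarithm by eventually_elim simp
  qed simp
  have "AE \<omega> in M. \<forall>x1\<in>{1, -1, 0}. \<forall>x2\<in>{1, -1, 0}. x1\<^sup>2 + x2\<^sup>2 \<noteq> 0 \<longrightarrow>
      limsup (\<lambda>n. ereal (centred_sum x1 x2 n \<omega> / lil_scale n)) = ereal (erw_sigma p q x1 x2) \<and>
      liminf (\<lambda>n. ereal (centred_sum x1 x2 n \<omega> / lil_scale n)) = ereal (- erw_sigma p q x1 x2)"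
    by (intro AE_finite_allI lil) auto
  moreover have "AE \<omega> in M. eta 2 \<omega> \<in> {1, -1, 0}" by (rule AE_eta) simp
  ultimately show ?thesis
    using AE_X1
  proof eventually_elim
    case (elim \<omega>)
    show ?case
    proof
      assume nz: "(X1 \<omega>)\<^sup>2 + (X2 \<omega>)\<^sup>2 \<noteq> 0"
      have "X2 \<omega> \<in> {1, -1, 0}" using elim(2,3) by auto
      note lim = elim(1)[rule_format, OF elim(3) this nz]
      show "limsup (\<lambda>n. ereal (D n \<omega> / lil_scale n)) = ereal (erw_sigma p q (X1 \<omega>) (X2 \<omega>)) \<and>
          liminf (\<lambda>n. ereal (D n \<omega> / lil_scale n)) = ereal (- erw_sigma p q (X1 \<omega>) (X2 \<omega>)) \<and>
          (\<lambda>n. D n \<omega> / real n) \<longlonglongrightarrow> 0"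
        using lil_shift[of "\<lambda>n. D n \<omega>", OF D_eq lim[THEN conjunct1] lim[THEN conjunct2]] by blast
    qed
  qed
qed

text \<open>Away from zero first steps this is part of \<open>AE_lil\<close>. If both vanish, all
  later steps vanish as well, and so does \<open>D\<close> from time 2 on.\<close>

lemma AE_lln: "AE \<omega> in M. (\<lambda>n. D n \<omega> / real n) \<longlonglongrightarrow> 0"
  using AE_lil
proof eventually_elim
  case (elim \<omega>)
  show ?case
  proof (cases "(X1 \<omega>)\<^sup>2 + (X2 \<omega>)\<^sup>2 = 0")
    case True
    then have "X1 \<omega> = 0" by (simp add: sum_power2_eq_zero_iff)
    then have "D (n + 2) \<omega> = 0" for n
      unfolding D_eq by (simp add: erw_mu_def Y_def)
    then have "(\<lambda>n. D (n + 2) \<omega> / real (n + 2)) \<longlonglongrightarrow> 0" by (simp only: div_0 tendsto_const)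
    then show ?thesis by (rule LIMSEQ_offset[where k=2])
  qed (use elim in blast)
qed

section \<open>The limit law as a mixture over the first two steps\<close>

definition limit_cdf :: "real \<Rightarrow> real \<Rightarrow> real \<Rightarrow> real" where
  "limit_cdf x1 x2 y = (if x1\<^sup>2 + x2\<^sup>2 = 0 then if 0 \<le> y then 1 else 0 else Phi (y / erw_sigma p q x1 x2))"

text \<open>For zero first steps the sum is exactly 0, so convergence holds even at the jump
  \<open>y = 0\<close>. \<open>limit_cdf\<close> separates this case because dividing by a zero
  standard deviation gives 0 in HOL, and thus \<open>Phi 0\<close> instead of a jump.\<close>

lemma conditional_cdf:
  "(\<lambda>n. prob {\<omega> \<in> space M. (offset x1 x2 + centred_sum x1 x2 n \<omega>) / sqrt (real (n + 2)) \<le> y})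
     \<longlonglongrightarrow> limit_cdf x1 x2 y"
proof (cases "x1\<^sup>2 + x2\<^sup>2 = 0")
  case True
  then have "x1 = 0" "x2 = 0" by (simp_all add: sum_power2_eq_zero_iff)
  then show ?thesis
    using True by (simp add: Y_def erw_mu_def limit_cdf_def prob_space)
next
  case False
  then interpret iid: bounded_iid M "\<lambda>k \<omega>. Y x1 x2 k \<omega> - erw_mu p q x1 x2"
    "\<bar>x1\<bar> + \<bar>x2\<bar> + \<bar>erw_mu p q x1 x2\<bar>" "erw_sigma p q x1 x2"
    by (rule centred_Y_iid)
  have "limit_cdf x1 x2 y = cdf std_normal_distribution (y / erw_sigma p q x1 x2)"
    using False by (auto simp: limit_cdf_def Phi_def cdf_def)
  then show ?thesis using iid.clt_cdf_shifted[of "offset x1 x2" y] by (simp only:)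
qed

text \<open>With constants \<open>x1\<close> and \<open>x2\<close>, \<open>centred_sum\<close> is a
  function of signs and memories from index 3 on, a set of coordinates disjoint from those of
  \<open>X1\<close> and \<open>eta 2\<close>.\<close>

lemma prob_first_steps_indep:
  assumes a: "a \<in> {1, -1, 0}" and e: "e \<in> {1, -1, 0}"
  shows "prob {\<omega> \<in> space M. X1 \<omega> = a \<and> eta 2 \<omega> = e \<and> (c + centred_sum x1 x2 n \<omega>) / b \<le> y} =
    weight a * weight e * prob {\<omega> \<in> space M. (c + centred_sum x1 x2 n \<omega>) / b \<le> y}"
proof -
  define A where "A = {IX1, IEta 2}"
  define I where "I = IEta ` {3..} \<union> IK ` {3..}"
  define g where "g x = (if x IX1 = a \<and> x (IEta 2) = e then 1 else 0 :: real)" for x :: "erw_idx \<Rightarrow> real"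
  define h where "h x = (c + (\<Sum>k<n. x (IEta (k + 3)) * (if x (IK (k + 3)) = 1 then x1 else x2) - erw_mu p q x1 x2)) / b"
    for x :: "erw_idx \<Rightarrow> real"
  let ?F = "\<lambda>\<omega> i. erw_family X1 eta K i \<omega>"
  have "indep_var borel (g \<circ> (\<lambda>\<omega>. restrict (?F \<omega>) A)) borel (h \<circ> (\<lambda>\<omega>. restrict (?F \<omega>) I))"
  proof (rule indep_var_compose[OF indep_var_restrict[OF indep]])
    show "A \<inter> I = {}" "A \<subseteq> erw_index" "I \<subseteq> erw_index" by (auto simp: A_def I_def erw_index_def)
    have [simp]: "IX1 \<in> A" "IEta 2 \<in> A" "IEta (k + 3) \<in> I" "IK (k + 3) \<in> I" for k
      by (auto simp: A_def I_def)
    have [measurable]: "(\<lambda>x. x i) \<in> borel_measurable (PiM J (\<lambda>_. borel :: real measure))" if "i \<in> J"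
      for i and J :: "erw_idx set"
      using that by (rule measurable_component_singleton)
    show "g \<in> borel_measurable (PiM A (\<lambda>_. borel))" unfolding g_def[abs_def] by measurable
    show "h \<in> borel_measurable (PiM I (\<lambda>_. borel))" unfolding h_def[abs_def] by measurable
  qed
  moreover have "g \<circ> (\<lambda>\<omega>. restrict (?F \<omega>) A) = (\<lambda>\<omega>. if X1 \<omega> = a \<and> eta 2 \<omega> = e then 1 else 0)"
    by (simp add: g_def A_def erw_family_def comp_def)
  moreover have "h \<circ> (\<lambda>\<omega>. restrict (?F \<omega>) I) = (\<lambda>\<omega>. (c + centred_sum x1 x2 n \<omega>) / b)"
  proof -
    have "IEta (k + 3) \<in> I" "IK (k + 3) \<in> I" for k by (auto simp: I_def)
    then show ?thesis by (simp add: fun_eq_iff h_def Y_def erw_family_def)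
  qed
  ultimately have "indep_var borel (\<lambda>\<omega>. if X1 \<omega> = a \<and> eta 2 \<omega> = e then 1 else 0 :: real)
      borel (\<lambda>\<omega>. (c + centred_sum x1 x2 n \<omega>) / b)" (is "indep_var borel ?U borel ?V")
    by simp
  then have "prob ((\<lambda>\<omega>. (?U \<omega>, ?V \<omega>)) -` ({1} \<times> {..y}) \<inter> space M) =
      prob (?U -` {1} \<inter> space M) * prob (?V -` {..y} \<inter> space M)"
    by (rule indep_varD) auto
  moreover have "(\<lambda>\<omega>. (?U \<omega>, ?V \<omega>)) -` ({1} \<times> {..y}) \<inter> space M =
      {\<omega> \<in> space M. X1 \<omega> = a \<and> eta 2 \<omega> = e \<and> ?V \<omega> \<le> y}"
    by (auto split: if_splits)
  moreover have "?U -` {1} \<inter> space M = {\<omega> \<in> space M. X1 \<omega> = a \<and> eta 2 \<omega> = e}"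
    by (auto split: if_splits)
  moreover have "?V -` {..y} \<inter> space M = {\<omega> \<in> space M. ?V \<omega> \<le> y}" by auto
  ultimately show ?thesis using prob_X1_eta2[OF a e] by simp
qed

lemma D_rv [measurable]: "random_variable borel (D n)"
proof -
  have "random_variable borel (erw_X X1 eta K k)" for k
  proof -
    consider "k = 0" | "k = Suc 0" | "k = Suc (Suc 0)" | j where "k = Suc (Suc (Suc j))"
      by (metis not0_implies_Suc)
    then show ?thesis
    proof cases
      case 1
      then have "erw_X X1 eta K k = (\<lambda>_. 0)" by (simp add: fun_eq_iff)
      then show ?thesis by simp
    next
      case 2
      then have "erw_X X1 eta K k = X1" by (simp add: fun_eq_iff)
      then show ?thesis by simp
    next
      case 3
      then have "erw_X X1 eta K k = X2" by (simp add: fun_eq_iff)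
      then show ?thesis by simp
    next
      case 4
      have [measurable]: "random_variable borel (eta (j + 3))" "random_variable (count_space UNIV) (K (j + 3))"
        by (auto intro: eta_rv K_rv)
      have "erw_X X1 eta K k = (\<lambda>\<omega>. eta (j + 3) \<omega> * (if K (j + 3) \<omega> = 1 then X1 \<omega> else X2 \<omega>))"
        using 4 by (simp add: fun_eq_iff)
      then show ?thesis by simp
    qed
  qed
  then have [measurable]: "random_variable borel (erw_S X1 eta K n)"
    unfolding erw_S_def[abs_def] by measurable
  show ?thesis by measurable
qed

text \<open>On the event that \<open>X1 = a\<close> and \<open>eta 2 = e\<close> the random
  coefficients of the centred walk become the constants \<open>a\<close> and \<open>e * a\<close>,
  so independence applies on each of the nine pieces.\<close>

lemma prob_D_le:
  "prob {\<omega> \<in> space M. D (n + 2) \<omega> / sqrt (real (n + 2)) \<le> y} =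
    (\<Sum>(a, e)\<in>{1, -1, 0} \<times> {1, -1, 0}. weight a * weight e *
       prob {\<omega> \<in> space M. (offset a (e * a) + centred_sum a (e * a) n \<omega>) / sqrt (real (n + 2)) \<le> y})"
proof -
  define D' where "D' \<omega> = D (n + 2) \<omega> / sqrt (real (n + 2))" for \<omega>
  define V where "V a e = {\<omega> \<in> space M. X1 \<omega> = a \<and> eta 2 \<omega> = e \<and> D' \<omega> \<le> y}" for a e
  let ?I = "{1, -1, 0 :: real} \<times> {1, -1, 0 :: real}"
  have [measurable]: "random_variable borel D'" unfolding D'_def[abs_def] by measurable
  have V_meas [measurable]: "V a e \<in> events" for a e unfolding V_def by measurable
  have "AE \<omega> in M. eta 2 \<omega> \<in> {1, -1, 0}" by (rule AE_eta) simp
  with AE_X1 have "AE \<omega> in M. \<omega> \<in> {\<omega> \<in> space M. D' \<omega> \<le> y} \<longleftrightarrow> \<omega> \<in> (\<Union>z\<in>?I. V (fst z) (snd z))"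
  proof eventually_elim
    case (elim \<omega>)
    then have I: "(X1 \<omega>, eta 2 \<omega>) \<in> ?I" by (simp only: mem_Times_iff fst_conv snd_conv)
    show ?case
    proof
      assume "\<omega> \<in> {\<omega> \<in> space M. D' \<omega> \<le> y}"
      then show "\<omega> \<in> (\<Union>z\<in>?I. V (fst z) (snd z))"
        by (intro UN_I[OF I]) (simp add: V_def)
    next
      assume "\<omega> \<in> (\<Union>z\<in>?I. V (fst z) (snd z))"
      then show "\<omega> \<in> {\<omega> \<in> space M. D' \<omega> \<le> y}"
        by (rule UN_E) (simp add: V_def)
    qed
  qed
  then have "prob {\<omega> \<in> space M. D' \<omega> \<le> y} = prob (\<Union>z\<in>?I. V (fst z) (snd z))"
    by (rule finite_measure_eq_AE) (auto intro!: sets.finite_UN V_meas simp del: UN_insert)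
  also have "\<dots> = (\<Sum>z\<in>?I. prob (V (fst z) (snd z)))"
  proof (rule finite_measure_finite_Union)
    have "V (fst z) (snd z) \<inter> V (fst z') (snd z') = {}" if "z \<noteq> z'" for z z' :: "real \<times> real"
      using that by (auto simp: V_def prod_eq_iff)
    then show "disjoint_family_on (\<lambda>z. V (fst z) (snd z)) ?I"
      unfolding disjoint_family_on_def by blast
    show "(\<lambda>z. V (fst z) (snd z)) ` ?I \<subseteq> events" using V_meas by blast
  qed simp
  also have "\<dots> = (\<Sum>z\<in>?I. weight (fst z) * weight (snd z) *
      prob {\<omega> \<in> space M. (offset (fst z) (snd z * fst z) + centred_sum (fst z) (snd z * fst z) n \<omega>)
        / sqrt (real (n + 2)) \<le> y})"
  proof (intro sum.cong refl)
    fix z assume "z \<in> ?I"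
    then have z: "fst z \<in> {1, -1, 0}" "snd z \<in> {1, -1, 0}" by auto
    have "V (fst z) (snd z) = {\<omega> \<in> space M. X1 \<omega> = fst z \<and> eta 2 \<omega> = snd z \<and>
        (offset (fst z) (snd z * fst z) + centred_sum (fst z) (snd z * fst z) n \<omega>) / sqrt (real (n + 2)) \<le> y}"
      unfolding V_def D'_def D_eq by (intro Collect_cong conj_cong refl) (simp only:)
    then show "prob (V (fst z) (snd z)) = weight (fst z) * weight (snd z) *
      prob {\<omega> \<in> space M. (offset (fst z) (snd z * fst z) + centred_sum (fst z) (snd z * fst z) n \<omega>)
        / sqrt (real (n + 2)) \<le> y}"
      by (simp only: prob_first_steps_indep[OF z])
  qed
  finally show ?thesis unfolding D'_def case_prod_unfold .
qed

text \<open>For nonzero \<open>a\<close>, the cases \<open>e = 1\<close>, \<open>e = 0\<close> and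
  \<open>e = -1\<close> give equal steps, a zero second step and opposite steps, with deviations
  \<open>s1\<close>, \<open>s2\<close>, \<open>s3\<close>. These do not depend on the sign of
  \<open>a\<close>, whence the factor \<open>p + q\<close>. The three cases with
  \<open>a = 0\<close> add up to the atom of mass \<open>r\<close>.\<close>

lemma mixture_cdf:
  "(\<Sum>(a, e)\<in>{1, -1, 0} \<times> {1, -1, 0}. weight a * weight e * limit_cdf a (e * a) y) = erw_F p q r y"
proof -
  define s1 s2 s3 where "s1 = sqrt (p + q - (p - q)\<^sup>2)"
    and "s2 = sqrt ((p + q) / 2 - ((p - q) / 2)\<^sup>2)" and "s3 = sqrt (p + q)"
  have sigma: "erw_sigma p q 1 1 = s1" "erw_sigma p q (-1) (-1) = s1" "erw_sigma p q 1 0 = s2"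
    "erw_sigma p q (-1) 0 = s2" "erw_sigma p q 1 (-1) = s3" "erw_sigma p q (-1) 1 = s3"
    by (simp_all add: erw_sigma_def erw_mu_def s1_def s2_def s3_def power2_eq_square field_simps)
  have "(\<Sum>(a, e)\<in>{1, -1, 0} \<times> {1, -1, 0}. weight a * weight e * limit_cdf a (e * a) y) =
      (\<Sum>a\<in>{1, -1, 0}. \<Sum>e\<in>{1, -1, 0}. weight a * weight e * limit_cdf a (e * a) y)"
    by (rule sum.cartesian_product[symmetric])
  also have "\<dots> = p * (p + q) * Phi (y / s1) + r * (p + q) * Phi (y / s2) + q * (p + q) * Phi (y / s3)
      + (p + q + r) * (r * (if y \<ge> 0 then 1 else 0))"
    by (simp add: weight_def limit_cdf_def sigma algebra_simps)
  also have "\<dots> = erw_F p q r y"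
    unfolding pqr by (simp add: erw_F_def Let_def s1_def s2_def s3_def)
  finally show ?thesis .
qed

text \<open>Convergence at every \<open>y\<close>, including the discontinuity of
  \<open>erw_F\<close> at 0, which is more than weak convergence asks for.\<close>

lemma cdf_D: "(\<lambda>n. cdf (distr M borel (\<lambda>\<omega>. D n \<omega> / sqrt (real n))) y) \<longlonglongrightarrow> erw_F p q r y"
proof (rule LIMSEQ_offset[where k=2])
  have "(\<lambda>n. \<Sum>(a, e)\<in>{1, -1, 0} \<times> {1, -1, 0}. weight a * weight e *
       prob {\<omega> \<in> space M. (offset a (e * a) + centred_sum a (e * a) n \<omega>) / sqrt (real (n + 2)) \<le> y})
     \<longlonglongrightarrow> (\<Sum>(a, e)\<in>{1, -1, 0} \<times> {1, -1, 0}. weight a * weight e * limit_cdf a (e * a) y)"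
    unfolding case_prod_unfold by (intro tendsto_sum tendsto_mult tendsto_const conditional_cdf)
  moreover have "cdf (distr M borel (\<lambda>\<omega>. D n \<omega> / sqrt (real n))) y =
      prob {\<omega> \<in> space M. D n \<omega> / sqrt (real n) \<le> y}" for n
    unfolding cdf_def by (subst measure_distr) (auto intro!: arg_cong[where f=prob])
  ultimately show "(\<lambda>n. cdf (distr M borel (\<lambda>\<omega>. D (n + 2) \<omega> / sqrt (real (n + 2)))) y) \<longlonglongrightarrow> erw_F p q r y"
    unfolding prob_D_le[symmetric] mixture_cdf by (simp only:)
qed

end

theorem theorem6p2:
  fixes M :: "'a measure" and p q r :: real
    and X1 :: "'a \<Rightarrow> real" and eta :: "nat \<Rightarrow> 'a \<Rightarrow> real" and K :: "nat \<Rightarrow> 'a \<Rightarrow> nat"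
  assumes "prob_space M"
    and "p \<in> {0<..<1}" and "q \<in> {0<..<1}" and "r \<in> {0<..<1}" and "p + q + r = 1"
    and "prob_space.indep_vars M (\<lambda>_. borel) (erw_family X1 eta K) erw_index"
    and "X1 \<in> borel_measurable M"
    and "\<And>n. n \<ge> 2 \<Longrightarrow> eta n \<in> borel_measurable M"
    and "\<And>n. n \<ge> 3 \<Longrightarrow> K n \<in> measurable M (count_space UNIV)"
    and "measure M {\<omega> \<in> space M. X1 \<omega> = 1} = p"
    and "measure M {\<omega> \<in> space M. X1 \<omega> = -1} = q"
    and "measure M {\<omega> \<in> space M. X1 \<omega> = 0} = r"
    and "\<And>n. n \<ge> 2 \<Longrightarrow> measure M {\<omega> \<in> space M. eta n \<omega> = 1} = p"
    and "\<And>n. n \<ge> 2 \<Longrightarrow> measure M {\<omega> \<in> space M. eta n \<omega> = -1} = q"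
    and "\<And>n. n \<ge> 2 \<Longrightarrow> measure M {\<omega> \<in> space M. eta n \<omega> = 0} = r"
    and "\<And>n. n \<ge> 3 \<Longrightarrow> measure M {\<omega> \<in> space M. K n \<omega> = 1} = 1/2"
    and "\<And>n. n \<ge> 3 \<Longrightarrow> measure M {\<omega> \<in> space M. K n \<omega> = 2} = 1/2"
  defines "D \<equiv> (\<lambda>n \<omega>. erw_S X1 eta K n \<omega>
                  - real n * (p - q) * (erw_X X1 eta K 1 \<omega> + erw_X X1 eta K 2 \<omega>) / 2)"
  shows
    "weak_conv (\<lambda>n. cdf (distr M borel (\<lambda>\<omega>. D n \<omega> / sqrt (real n)))) (erw_F p q r)
     \<and> (AE \<omega> in M. (\<lambda>n. D n \<omega> / real n) \<longlonglongrightarrow> 0)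
     \<and> (AE \<omega> in M. (erw_X X1 eta K 1 \<omega>)\<^sup>2 + (erw_X X1 eta K 2 \<omega>)\<^sup>2 \<noteq> 0 \<longrightarrow>
          limsup (\<lambda>n. ereal (D n \<omega> / sqrt (2 * real n * ln (ln (real n)))))
            = ereal (erw_sigma p q (erw_X X1 eta K 1 \<omega>) (erw_X X1 eta K 2 \<omega>))
        \<and> liminf (\<lambda>n. ereal (D n \<omega> / sqrt (2 * real n * ln (ln (real n)))))
            = ereal (- erw_sigma p q (erw_X X1 eta K 1 \<omega>) (erw_X X1 eta K 2 \<omega>)))"
proof -
  interpret prob_space M by fact
  interpret two_step_erw M p q r X1 eta K
    using assms(2-17) by unfold_locales (simp_all add: greaterThanLessThan_iff)
  have steps: "erw_X X1 eta K 1 \<omega> = X1 \<omega>" "erw_X X1 eta K 2 \<omega> = eta 2 \<omega> * X1 \<omega>" for \<omega>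
    by (simp_all add: numeral_2_eq_2)
  have "weak_conv (\<lambda>n. cdf (distr M borel (\<lambda>\<omega>. D n \<omega> / sqrt (real n)))) (erw_F p q r)"
    unfolding weak_conv_def D_def steps using cdf_D by blast
  moreover have "AE \<omega> in M. (\<lambda>n. D n \<omega> / real n) \<longlonglongrightarrow> 0"
    unfolding D_def steps by (rule AE_lln)
  moreover have "AE \<omega> in M. (erw_X X1 eta K 1 \<omega>)\<^sup>2 + (erw_X X1 eta K 2 \<omega>)\<^sup>2 \<noteq> 0 \<longrightarrow>
          limsup (\<lambda>n. ereal (D n \<omega> / sqrt (2 * real n * ln (ln (real n)))))
            = ereal (erw_sigma p q (erw_X X1 eta K 1 \<omega>) (erw_X X1 eta K 2 \<omega>))
        \<and> liminf (\<lambda>n. ereal (D n \<omega> / sqrt (2 * real n * ln (ln (real n)))))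
            = ereal (- erw_sigma p q (erw_X X1 eta K 1 \<omega>) (erw_X X1 eta K 2 \<omega>))"
    unfolding D_def steps lil_scale_def[symmetric] using AE_lil by eventually_elim blast
  ultimately show ?thesis by blast
qed

end
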